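(* Let $\mathcal{QT}_{q^m}(s)$ be the complexity of computing the $q$-transform, or the inverse $q$-transform, of a linearized polynomial $a$ over $\mathbb{F}_{q^m}$ with $\deg_q a<s$, where $s$ divides $m$ and a normal basis $\{\beta^{[0]},\dots,\beta^{[s-1]}\}$ of $\mathbb{F}_{q^s}\subseteq\mathbb{F}_{q^m}$ over $\mathbb{F}_q$ is given. Then $$\mathcal{QT}_{q^m}(s)\in\mathcal{O}\left(s\log^2(s)\log(\log(s))\right).$$
   Context: Let $q$ be a prime power and $[i]:=q^i$. A linearized polynomial over $\mathbb{F}_{q^m}$ is a polynomial $a=\sum_k a_k x^{[k]}$, $a_k\in\mathbb{F}_{q^m}$, with $q$-degree $\deg_q a=\max\{k:a_k\ne0\}$; its evaluation at $\alpha\in\mathbb{F}_{q^m}$ is $a(\alpha)=\sum_k a_k\alpha^{[k]}$. Let $s\mid m$ and let $\{\beta^{[0]},\dots,\beta^{[s-1]}\}$ be a normal basis of $\mathbb{F}_{q^s}\subseteq\mathbb{F}_{q^m}$ over $\mathbb{F}_q$. The $q$-transform (with respect to $s$ and this basis) is the bijection $a\mapsto\hat a$ from the set of linearized polynomials over $\mathbb{F}_{q^m}$ of $q$-degree $<s$ to itself, given by $$\hat a_j=a(\beta^{[j]})=\sum_{i=0}^{s-1}a_i\beta^{[i+j]},\qquad j=0,\dots,s-1.$$ The inverse $q$-transform is the inverse of this map. Complexity model: complexities are worst-case numbers of operations in $\mathbb{F}_{q^m}$; the complexity of a problem is the infimum of the worst-case complexities of algorithms solving it. Elements of $\mathbb{F}_{q^m}$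 are thought of as represented in a normal basis over $\mathbb{F}_q$, so that applying any automorphism in $\mathrm{Gal}(\mathbb{F}_{q^m}/\mathbb{F}_q)$ counts as $\mathcal{O}(1)$ operations in $\mathbb{F}_{q^m}$. Implied constants do not depend on $m$. *)

theory Defs
  imports Complex_Main "HOL-Computational_Algebra.Computational_Algebra"
    "HOL-Library.Extended_Real"
begin

section \<open>Finite fields\<close>

text \<open>
  All finite fields of characteristic \<open>p\<close> live inside one algebraically closed field of
  characteristic \<open>p\<close>: there the field of order \<open>n = p ^ k\<close> is the set of roots of \<open>X ^ n - X\<close>.
\<close>

definition GF :: "nat \<Rightarrow> 'a::field set" where
  "GF n = {x. x ^ n = x}"

lemma card_GF:
  fixes k :: nat
  assumes "prime CHAR('a::alg_closed_field)" and "k > 0"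
  shows "card (GF (CHAR('a) ^ k) :: 'a set) = CHAR('a) ^ k"
proof -
  define n where "n = CHAR('a) ^ k"
  have "CHAR('a) > 1"
    using assms(1) by (rule prime_gt_1_nat)
  then have n: "n > 1"
    unfolding n_def using assms(2) by (rule one_less_power)
  define f :: "'a poly" where "f = monom 1 n - monom 1 1"
  have deg: "degree f = n"
    unfolding f_def using n
    by (subst diff_conv_add_uminus, subst degree_add_eq_left) (auto simp: degree_monom_eq)
  have f0: "f \<noteq> 0"
    using deg n by auto
  have char: "(of_nat n :: 'a) = 0"
    using assms(2) by (simp add: of_nat_eq_0_iff_char_dvd n_def)
  have deriv: "pderiv f = - 1"
    using char by (simp add: f_def pderiv_diff pderiv_monom monom_0 one_pCons)
  have ord: "order x f \<le> 1" for x
  proof (rule ccontr)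
    assume "\<not> order x f \<le> 1"
    then have "[:- x, 1:] ^ 2 dvd f"
      by (simp add: order_divides)
    then obtain g where "f = [:- x, 1:] ^ 2 * g" ..
    then have "pderiv f = [:- x, 1:] * ([:- x, 1:] * pderiv g + 2 * g * pderiv [:- x, 1:])"
      by (simp only: pderiv_mult power2_eq_square) (simp only: algebra_simps mult_2)
    then have "poly (pderiv f) x = 0"
      by (simp only: poly_mult) simp
    then show False
      by (simp add: deriv)
  qed
  obtain A where A: "size A = degree f" "f = smult (lead_coeff f) (\<Prod>x\<in>#A. [:- x, 1:])"
    using alg_closed_imp_factorization[OF f0] by blast
  have "proots f = proots (\<Prod>x\<in>#A. [:- x, 1:])"
    using f0 by (subst A(2)) simp
  also have "\<dots> = A"
  proof (induction A)
    case (add y A)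
    have "(\<Prod>x\<in>#A. [:- x, 1:]) \<noteq> 0"
      by (auto simp: prod_mset_zero_iff)
    then show ?case
      using add by (simp add: proots_mult del: mult_pCons_left)
  qed auto
  finally have "size (proots f) = n"
    using A(1) deg by simp
  moreover have "set_mset (proots f) = GF n"
    using f0 by (auto simp: GF_def f_def poly_monom)
  moreover have "proots f = mset_set (set_mset (proots f))"
  proof (rule multiset_eqI)
    fix x
    have "count (proots f) x \<le> 1"
      using ord f0 by simp
    then show "count (proots f) x = count (mset_set (set_mset (proots f))) x"
      by (metis One_nat_def count_greater_eq_one_iff count_mset_set(1,3) finite_set_mset
          le_antisym not_in_iff)
  qed
  ultimately show ?thesis
    by (metis n_def size_mset_set)
qed

definition galois_group :: "'a::field set \<Rightarrow> 'a set \<Rightarrow> ('a \<Rightarrow> 'a) set" where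
  "galois_group K k = {\<sigma>. bij_betw \<sigma> K K \<and>
     (\<forall>x\<in>K. \<forall>y\<in>K. \<sigma> (x + y) = \<sigma> x + \<sigma> y \<and> \<sigma> (x * y) = \<sigma> x * \<sigma> y) \<and>
     (\<forall>x\<in>k. \<sigma> x = x)}"

text \<open>\<open>\<beta>\<close> generates a normal basis of the field of order \<open>q ^ s\<close> over that of order \<open>q\<close>.\<close>

definition normal_basis_generator :: "nat \<Rightarrow> nat \<Rightarrow> 'a::field \<Rightarrow> bool" where
  "normal_basis_generator q s \<beta> \<longleftrightarrow>
     \<beta> \<in> GF (q ^ s) \<and>
     (\<forall>c. (\<forall>i<s. c i \<in> GF q) \<and> (\<Sum>i<s. c i * \<beta> ^ (q ^ i)) = 0 \<longrightarrow> (\<forall>i<s. c i = 0)) \<and>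
     (\<forall>x\<in>GF (q ^ s). \<exists>c. (\<forall>i<s. c i \<in> GF q) \<and> x = (\<Sum>i<s. c i * \<beta> ^ (q ^ i)))"


section \<open>Linearized polynomials and the \<open>q\<close>-transform\<close>

definition linearized :: "nat \<Rightarrow> 'a::field set \<Rightarrow> 'a poly \<Rightarrow> bool" where
  "linearized q K a \<longleftrightarrow>
     (\<forall>i. coeff a i \<in> K) \<and> (\<forall>i. coeff a i \<noteq> 0 \<longrightarrow> (\<exists>k. i = q ^ k))"

definition q_degree :: "nat \<Rightarrow> 'a::field poly \<Rightarrow> nat" where
  "q_degree q a = Max {k. coeff a (q ^ k) \<noteq> 0}"

text \<open>The zero polynomial has \<open>q\<close>-degree minus infinity, hence the separate case.\<close>

definition lin_polys :: "nat \<Rightarrow> 'a::field set \<Rightarrow> nat \<Rightarrow> 'a poly set" where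
  "lin_polys q K s = {a. linearized q K a \<and> (a = 0 \<or> q_degree q a < s)}"

definition q_coeffs :: "nat \<Rightarrow> nat \<Rightarrow> 'a::field poly \<Rightarrow> 'a list" where
  "q_coeffs q s a = map (\<lambda>k. coeff a (q ^ k)) [0..<s]"

definition q_transform :: "nat \<Rightarrow> nat \<Rightarrow> 'a::field \<Rightarrow> 'a poly \<Rightarrow> 'a poly" where
  "q_transform q s \<beta> a = (\<Sum>j<s. monom (poly a (\<beta> ^ (q ^ j))) (q ^ j))"

definition inv_q_transform ::
    "nat \<Rightarrow> 'a::field set \<Rightarrow> nat \<Rightarrow> 'a \<Rightarrow> 'a poly \<Rightarrow> 'a poly" where
  "inv_q_transform q K s \<beta> = inv_into (lin_polys q K s) (q_transform q s \<beta>)"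


section \<open>Algebraic algorithms and complexity\<close>

text \<open>
  Algorithms over a field \<open>K\<close> are computation trees with zero tests.  The state is the list of
  all values available so far, initially the input; operands are positions in that list, and
  every operation appends its result.
\<close>

datatype 'a operation =
    Const 'a
  | Add nat nat
  | Sub nat nat
  | Mul nat nat
  | Div nat nat
  | Aut "'a \<Rightarrow> 'a" nat

datatype 'a algorithm =
    Return "nat list"
  | Compute "'a operation" "'a algorithm"
  | If_Zero nat "'a algorithm" "'a algorithm"

definition lookup :: "'a list \<Rightarrow> nat \<Rightarrow> 'a option" where
  "lookup xs i = (if i < length xs then Some (xs ! i) else None)"

text \<open>
  \<open>G\<close> is the set of automorphisms that may be applied at unit cost.  The result \<open>None\<close> signals
  an illegal step.
\<close>

fun exec :: "'a::field set \<Rightarrow> ('a \<Rightarrow> 'a) set \<Rightarrow> 'a operation \<Rightarrow> 'a list \<Rightarrow> 'a option" where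
  "exec K G (Const c) xs = (if c \<in> K then Some c else None)"
| "exec K G (Add i j) xs =
     Option.bind (lookup xs i) (\<lambda>x. Option.bind (lookup xs j) (\<lambda>y. Some (x + y)))"
| "exec K G (Sub i j) xs =
     Option.bind (lookup xs i) (\<lambda>x. Option.bind (lookup xs j) (\<lambda>y. Some (x - y)))"
| "exec K G (Mul i j) xs =
     Option.bind (lookup xs i) (\<lambda>x. Option.bind (lookup xs j) (\<lambda>y. Some (x * y)))"
| "exec K G (Div i j) xs =
     Option.bind (lookup xs i) (\<lambda>x. Option.bind (lookup xs j)
       (\<lambda>y. if y = 0 then None else Some (x / y)))"
| "exec K G (Aut \<sigma> i) xs =
     (if \<sigma> \<in> G then map_option \<sigma> (lookup xs i) else None)"

text \<open>The second component of the result is the number of operations and tests performed.\<close>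

fun run :: "'a::field set \<Rightarrow> ('a \<Rightarrow> 'a) set \<Rightarrow> 'a algorithm \<Rightarrow> 'a list \<Rightarrow> ('a list \<times> nat) option" where
  "run K G (Return is) xs =
     (if \<forall>i\<in>set is. i < length xs then Some (map (\<lambda>i. xs ! i) is, 0) else None)"
| "run K G (Compute f t) xs =
     Option.bind (exec K G f xs) (\<lambda>x. map_option (apsnd Suc) (run K G t (xs @ [x])))"
| "run K G (If_Zero i t u) xs =
     Option.bind (lookup xs i) (\<lambda>x. map_option (apsnd Suc) (run K G (if x = 0 then t else u) xs))"

text \<open>A computational problem is given by its set of pairs of an input and the required output.\<close>

definition solves ::
    "'a::field set \<Rightarrow> ('a \<Rightarrow> 'a) set \<Rightarrow> 'a algorithm \<Rightarrow> ('a list \<times> 'a list) set \<Rightarrow> bool" where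
  "solves K G t P \<longleftrightarrow> (\<forall>(x, y)\<in>P. \<exists>n. run K G t x = Some (y, n))"

definition worst_case_cost ::
    "'a::field set \<Rightarrow> ('a \<Rightarrow> 'a) set \<Rightarrow> 'a algorithm \<Rightarrow> ('a list \<times> 'a list) set \<Rightarrow> enat" where
  "worst_case_cost K G t P = (SUP (x, y)\<in>P. enat (snd (the (run K G t x))))"

text \<open>Infinity if no algorithm solves the problem.\<close>

definition complexity ::
    "'a::field set \<Rightarrow> ('a \<Rightarrow> 'a) set \<Rightarrow> ('a list \<times> 'a list) set \<Rightarrow> enat" where
  "complexity K G P = (INF t\<in>{t. solves K G t P}. worst_case_cost K G t P)"


section \<open>The complexity of the \<open>q\<close>-transform\<close>

text \<open>The normal basis is part of the input, so nothing may be precomputed from it for free.\<close>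

definition q_transform_problem ::
    "nat \<Rightarrow> 'a::field set \<Rightarrow> nat \<Rightarrow> ('a list \<times> 'a list) set" where
  "q_transform_problem q K s =
     {(q_coeffs q s a @ map (\<lambda>i. \<beta> ^ (q ^ i)) [0..<s], q_coeffs q s (q_transform q s \<beta> a)) | a \<beta>.
        a \<in> lin_polys q K s \<and> normal_basis_generator q s \<beta>}"

definition inv_q_transform_problem ::
    "nat \<Rightarrow> 'a::field set \<Rightarrow> nat \<Rightarrow> ('a list \<times> 'a list) set" where
  "inv_q_transform_problem q K s =
     {(q_coeffs q s a @ map (\<lambda>i. \<beta> ^ (q ^ i)) [0..<s], q_coeffs q s (inv_q_transform q K s \<beta> a)) | a \<beta>.
        a \<in> lin_polys q K s \<and> normal_basis_generator q s \<beta>}"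

definition QT :: "nat \<Rightarrow> 'a::field set \<Rightarrow> nat \<Rightarrow> enat" where
  "QT q K s =
     max (complexity K (galois_group K (GF q)) (q_transform_problem q K s))
         (complexity K (galois_group K (GF q)) (inv_q_transform_problem q K s))"

end

theory Submission
  imports Defs
begin

text \<open>
  Both transforms apply a Hankel matrix with entries \<open>h (i + j)\<close>: for the \<open>q\<close>-transform
  \<open>h t = \<beta> ^ (q ^ t)\<close>, and for the inverse \<open>h\<close> is periodic with period \<open>s\<close>.  If \<open>h\<close> is constant,
  this is a multiplication by a fixed polynomial, done by an additive FFT: the polynomials
  \<open>L\<^sub>0 = X\<close>, \<open>L\<^sub>k\<^sub>+\<^sub>1 = L\<^sub>k ^ q - w ^ (q - 1) * L\<^sub>k\<close> with \<open>w\<close> a nonzero value of \<open>L\<^sub>k\<close> are linearized,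
  hence have only \<open>k + 1\<close> terms, and \<open>L\<^sub>k\<^sub>+\<^sub>1 - d\<close> splits into \<open>q\<close> factors \<open>L\<^sub>k - \<delta>\<close> with constants \<open>\<delta>\<close>.
  Chinese remaindering along these factors multiplies modulo \<open>L\<^sub>k - d\<close> in \<open>O(q ^ k * k\<^sup>2)\<close> operations
  for fixed \<open>q\<close>.

  The normal basis is not constant, but it comes from the field of order \<open>q ^ s\<close>.  For a fixed
  generator \<open>\<gamma>\<close>, the traces of \<open>\<gamma> ^ (q ^ j) * \<beta>\<close> form a Hankel product with constant matrix, lie in
  the field of order \<open>q\<close> and determine \<open>\<beta>\<close>.  At most \<open>q\<close> zero tests on each of them lead to a leaf
  of the computation tree at which \<open>\<beta>\<close>, and thus \<open>h\<close>, is a known constant.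
\<close>

section \<open>Polynomials over a field\<close>

lemma mod_linear: "f mod [:- d, 1:] = [:poly f d:]" for f :: "'a::field poly"
proof -
  have "f mod [:- d, 1:] = ([:- d, 1:] * synthetic_div f d + [:poly f d:]) mod [:- d, 1:]"
    by (simp only: synthetic_div_correct')
  also have "\<dots> = [:poly f d:] mod [:- d, 1:]"
    by (rule mod_mult_self4)
  also have "\<dots> = [:poly f d:]"
    by (rule mod_poly_less) simp
  finally show ?thesis .
qed

lemma smult_sum_right: "smult c (sum f I) = (\<Sum>i\<in>I. smult c (f i))" for f :: "'i \<Rightarrow> 'a::field poly"
  by (induction I rule: infinite_finite_induct) (auto simp: smult_add_right)

text \<open>Both sides are monic of degree \<open>card D\<close> and agree on \<open>D\<close>; the
  common leading coefficient makes up for the one missing evaluation point.\<close>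

lemma monic_eq_prod_roots:
  fixes g :: "'a::field poly"
  assumes "finite D" "card D = degree g" "lead_coeff g = 1" "\<And>\<delta>. \<delta> \<in> D \<Longrightarrow> poly g \<delta> = 0"
  shows "g = (\<Prod>\<delta>\<in>D. [:- \<delta>, 1:])"
proof (rule poly_eqI_degree_lead_coeff)
  have deg: "degree (\<Prod>\<delta>\<in>D. [:- \<delta>, 1:]) = degree g"
    using assms by (subst degree_prod_sum_eq) auto
  then show "degree (\<Prod>\<delta>\<in>D. [:- \<delta>, 1:]) \<le> degree g" by simp
  have "lead_coeff (\<Prod>\<delta>\<in>D. [:- \<delta>, 1:]) = 1"
    by (subst lead_coeff_prod) simp
  then show "coeff g (degree g) = coeff (\<Prod>\<delta>\<in>D. [:- \<delta>, 1:]) (degree g)"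
    using assms deg by simp
  fix \<delta> assume \<delta>: "\<delta> \<in> D"
  then have "(\<Prod>\<epsilon>\<in>D. poly [:- \<epsilon>, 1:] \<delta>) = 0"
    using assms by (intro prod_zero) auto
  with \<delta> show "poly g \<delta> = poly (\<Prod>\<delta>\<in>D. [:- \<delta>, 1:]) \<delta>"
    using assms by (simp add: poly_prod)
qed (use assms in auto)

text \<open>Lagrange interpolation of the constant 1: both sides have degree below
  \<open>card D\<close> and agree on \<open>D\<close>.\<close>

lemma lagrange_partition_of_unity:
  fixes D :: "'a::field set"
  assumes "finite D" "D \<noteq> {}"
  shows "(\<Sum>\<delta>\<in>D. smult (inverse (\<Prod>\<epsilon>\<in>D - {\<delta>}. \<delta> - \<epsilon>)) (\<Prod>\<epsilon>\<in>D - {\<delta>}. [:- \<epsilon>, 1:])) = 1"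
    (is "sum ?f D = 1")
proof (rule poly_eqI_degree)
  have card: "card D > 0" using assms by (simp add: card_gt_0_iff)
  then show "degree (1 :: 'a poly) < card D" by simp
  have "degree (?f \<delta>) < card D" if "\<delta> \<in> D" for \<delta>
  proof -
    have "degree (?f \<delta>) \<le> degree (\<Prod>\<epsilon>\<in>D - {\<delta>}. [:- \<epsilon>, 1:])"
      by (rule degree_smult_le)
    also have "\<dots> \<le> (\<Sum>\<epsilon>\<in>D - {\<delta>}. 1)"
      using degree_prod_sum_le[of "D - {\<delta>}" "\<lambda>\<epsilon>. [:- \<epsilon>, 1:]"] assms by simp
    also have "\<dots> < card D"
      using that assms card by simp
    finally show ?thesis .
  qed
  with card show "degree (sum ?f D) < card D"
    by (intro degree_sum_less)
  fix \<delta> assume \<delta>: "\<delta> \<in> D"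
  have "poly (?f \<epsilon>) \<delta> = (if \<epsilon> = \<delta> then 1 else 0)" if "\<epsilon> \<in> D" for \<epsilon>
  proof (cases "\<epsilon> = \<delta>")
    case True
    have "(\<Prod>\<epsilon>\<in>D - {\<delta>}. \<delta> - \<epsilon>) \<noteq> 0"
      using assms by auto
    with True show ?thesis by (simp add: poly_prod)
  next
    case False
    then have "(\<Prod>\<eta>\<in>D - {\<epsilon>}. poly [:- \<eta>, 1:] \<delta>) = 0"
      using assms \<delta> by (intro prod_zero) auto
    with False show ?thesis by (simp add: poly_prod)
  qed
  then show "poly (sum ?f D) \<delta> = poly 1 \<delta>"
    using assms \<delta> by (simp add: poly_sum)
qed

text \<open>Chinese remaindering with explicit weights. Any two moduli \<open>V \<delta>\<close>
  differ by a constant, so substituting \<open>L\<close> into the Lagrange identity gives weights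
  that are scalars.\<close>

lemma crt_combination:
  fixes L R :: "'a::field poly" and D :: "'a set"
  defines "V \<equiv> \<lambda>\<delta>. L - [:\<delta>:]"
  assumes D: "finite D" "D \<noteq> {}" and L: "degree L > 0"
  shows "(\<Sum>\<delta>\<in>D. smult (inverse (\<Prod>\<epsilon>\<in>D - {\<delta>}. \<delta> - \<epsilon>)) (R mod V \<delta> * prod V (D - {\<delta>})))
    = R mod prod V D"
    (is "(\<Sum>\<delta>\<in>D. smult (?\<kappa> \<delta>) (R mod V \<delta> * ?P \<delta>)) = _")
proof -
  let ?Z = "\<Sum>\<delta>\<in>D. smult (?\<kappa> \<delta>) (R mod V \<delta> * ?P \<delta>)"
  have deg_V: "degree (V \<delta>) = degree L" for \<delta>
    unfolding V_def using L
    by (subst diff_conv_add_uminus, subst degree_add_eq_left) auto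
  have V_nz: "V \<delta> \<noteq> 0" for \<delta>
    using deg_V[of \<delta>] L by auto
  have deg_prod: "degree (prod V D) = card D * degree L"
    by (subst degree_prod_sum_eq) (auto simp: V_nz deg_V)
  have card: "card D > 0" using D by (simp add: card_gt_0_iff)
  have unity: "(\<Sum>\<delta>\<in>D. smult (?\<kappa> \<delta>) (?P \<delta>)) = 1"
  proof -
    have "pcompose [:- \<epsilon>, 1:] L = V \<epsilon>" for \<epsilon>
      by (simp add: V_def pcompose_pCons)
    then have "(\<Sum>\<delta>\<in>D. smult (?\<kappa> \<delta>) (?P \<delta>)) = pcompose (\<Sum>\<delta>\<in>D. smult (?\<kappa> \<delta>)
        (\<Prod>\<epsilon>\<in>D - {\<delta>}. [:- \<epsilon>, 1:])) L"
      by (simp add: pcompose_sum pcompose_smult pcompose_prod)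
    also have "\<dots> = 1"
      by (subst lagrange_partition_of_unity[OF D]) (simp add: pcompose_1)
    finally show ?thesis .
  qed
  \<comment> \<open>Replacing \<open>R mod V \<delta>\<close> by \<open>R\<close> changes the
    summand only by a multiple of the full product.\<close>
  have "smult (?\<kappa> \<delta>) (R mod V \<delta> * ?P \<delta>) =
      R * smult (?\<kappa> \<delta>) (?P \<delta>) - prod V D * smult (?\<kappa> \<delta>) (R div V \<delta>)" if "\<delta> \<in> D" for \<delta>
  proof -
    have P: "prod V D = V \<delta> * ?P \<delta>"
      using D that by (simp add: prod.remove)
    have "R mod V \<delta> = R - R div V \<delta> * V \<delta>"
      by (simp add: minus_div_mult_eq_mod)
    then show ?thesis
      unfolding P by (simp only: left_diff_distrib right_diff_distrib smult_diff_right mult_smult_right mult_ac)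
  qed
  then have "?Z = R * (\<Sum>\<delta>\<in>D. smult (?\<kappa> \<delta>) (?P \<delta>))
      - prod V D * (\<Sum>\<delta>\<in>D. smult (?\<kappa> \<delta>) (R div V \<delta>))"
    by (simp add: sum_subtractf sum_distrib_left)
  then have "?Z mod prod V D = R mod prod V D"
    by (simp add: unity poly_mod_diff_left)
  \<comment> \<open>The combination has degree below that of the full product, so it is its own
    remainder.\<close>
  moreover have "degree (smult (?\<kappa> \<delta>) (R mod V \<delta> * ?P \<delta>)) < card D * degree L" if "\<delta> \<in> D" for \<delta>
  proof -
    have "degree (smult (?\<kappa> \<delta>) (R mod V \<delta> * ?P \<delta>)) \<le> degree (R mod V \<delta>) + degree (?P \<delta>)"
      by (meson degree_mult_le degree_smult_le order_trans)
    also have "degree (R mod V \<delta>) < degree L"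
      using degree_mod_less'[of "V \<delta>" R] V_nz[of \<delta>] L deg_V[of \<delta>]
      by (cases "R mod V \<delta> = 0") auto
    also have "degree (?P \<delta>) = card (D - {\<delta>}) * degree L"
      by (subst degree_prod_sum_eq) (auto simp: V_nz deg_V)
    also have "degree L + card (D - {\<delta>}) * degree L = card D * degree L"
      using D that card by (cases "card D") auto
    finally show ?thesis by simp
  qed
  then have "degree ?Z < card D * degree L"
    using card L by (intro degree_sum_less) auto
  ultimately show ?thesis
    using deg_prod by (simp add: mod_poly_less)
qed

lemma finite_support: "finite {i. coeff V i \<noteq> 0}"
  using MOST_coeff_eq_0[of V] by (simp add: MOST_iff_cofinite)

section \<open>Costs of computation trees\<close>

locale subfield =
  fixes K :: "'a::field set" and G :: "('a \<Rightarrow> 'a) set"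
  assumes zero_closed [simp]: "0 \<in> K" and one_closed [simp]: "1 \<in> K"
    and add_closed: "x \<in> K \<Longrightarrow> y \<in> K \<Longrightarrow> x + y \<in> K"
    and uminus_closed: "x \<in> K \<Longrightarrow> - x \<in> K"
    and mult_closed: "x \<in> K \<Longrightarrow> y \<in> K \<Longrightarrow> x * y \<in> K"
    and inverse_closed: "x \<in> K \<Longrightarrow> inverse x \<in> K"
begin

lemma diff_closed: "x \<in> K \<Longrightarrow> y \<in> K \<Longrightarrow> x - y \<in> K"
  using add_closed[of x "- y"] uminus_closed[of y] by simp

lemma power_closed: "x \<in> K \<Longrightarrow> x ^ n \<in> K"
  by (induction n) (auto intro: mult_closed)

lemma sum_closed: "(\<And>i. i \<in> I \<Longrightarrow> f i \<in> K) \<Longrightarrow> sum f I \<in> K"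
  by (induction I rule: infinite_finite_induct) (auto intro: add_closed)

lemma prod_closed: "(\<And>i. i \<in> I \<Longrightarrow> f i \<in> K) \<Longrightarrow> prod f I \<in> K"
  by (induction I rule: infinite_finite_induct) (auto intro: mult_closed)

lemma poly_closed: "(\<And>i. coeff p i \<in> K) \<Longrightarrow> x \<in> K \<Longrightarrow> poly p x \<in> K"
  unfolding poly_altdef by (intro sum_closed mult_closed power_closed) auto

text \<open>
  The values held by a running tree are viewed as functions of its input \<open>x\<close>.  Thus
  \<open>computes X S c gs\<close> says that from any state containing the quantities in \<open>S\<close>, at most \<open>c\<close>
  further steps suffice to return the list \<open>gs\<close>, for all inputs in \<open>X\<close>.
\<close>

definition computes :: "'x set \<Rightarrow> ('x \<Rightarrow> 'a) set \<Rightarrow> nat \<Rightarrow> ('x \<Rightarrow> 'a) list \<Rightarrow> bool" where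
  "computes X S c gs \<longleftrightarrow> (\<forall>fs. S \<subseteq> set fs \<longrightarrow>
     (\<exists>t. \<forall>x\<in>X. \<exists>n\<le>c. run K G t (map (\<lambda>f. f x) fs) = Some (map (\<lambda>g. g x) gs, n)))"

lemma computes_return:
  assumes "set gs \<subseteq> S"
  shows "computes X S c gs"
  unfolding computes_def
proof (intro allI impI)
  fix fs assume "S \<subseteq> set fs"
  then have "\<forall>g\<in>set gs. \<exists>i. i < length fs \<and> fs ! i = g"
    using assms by (metis in_set_conv_nth subsetD)
  then obtain pos where pos: "\<And>g. g \<in> set gs \<Longrightarrow> pos g < length fs \<and> fs ! pos g = g"
    by metis
  have "run K G (Return (map pos gs)) (map (\<lambda>f. f x) fs) = Some (map (\<lambda>g. g x) gs, 0)" for x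
    using pos by auto
  then show "\<exists>t. \<forall>x\<in>X. \<exists>n\<le>c. run K G t (map (\<lambda>f. f x) fs) = Some (map (\<lambda>g. g x) gs, n)"
    by blast
qed

lemma computes_cong:
  assumes "computes X S c gs" and "\<And>x. x \<in> X \<Longrightarrow> map (\<lambda>g. g x) gs = map (\<lambda>g. g x) hs"
  shows "computes X S c hs"
  using assms unfolding computes_def by (simp cong: ball_cong)

lemma computes_mono:
  assumes "computes X S c gs" "X' \<subseteq> X" "S \<subseteq> S'" "c \<le> c'"
  shows "computes X' S' c' gs"
  using assms unfolding computes_def by (meson order_trans subset_iff)

lemma computes_operation:
  assumes "computes X (insert h S) c gs"
    and "\<And>fs. S \<subseteq> set fs \<Longrightarrow> \<exists>f. \<forall>x. exec K G f (map (\<lambda>f. f x) fs) = Some (h x)"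
  shows "computes X S (Suc c) gs"
  unfolding computes_def
proof (intro allI impI)
  fix fs assume S: "S \<subseteq> set fs"
  from assms(2)[OF S] obtain f where f: "\<And>x. exec K G f (map (\<lambda>f. f x) fs) = Some (h x)"
    by blast
  from S have "insert h S \<subseteq> set (fs @ [h])" by auto
  from assms(1)[unfolded computes_def, rule_format, OF this] obtain t where
    t: "\<And>x. x \<in> X \<Longrightarrow> \<exists>n\<le>c. run K G t (map (\<lambda>f. f x) (fs @ [h])) = Some (map (\<lambda>g. g x) gs, n)"
    by auto
  have "\<exists>n\<le>Suc c. run K G (Compute f t) (map (\<lambda>f. f x) fs) = Some (map (\<lambda>g. g x) gs, n)"
    if "x \<in> X" for x
    using t[OF that] f[of x] by auto
  then show "\<exists>t. \<forall>x\<in>X. \<exists>n\<le>Suc c.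
      run K G t (map (\<lambda>f. f x) fs) = Some (map (\<lambda>g. g x) gs, n)"
    by blast
qed

lemma lookup_state:
  assumes "f \<in> S" "S \<subseteq> set fs"
  obtains i where "\<And>x. lookup (map (\<lambda>f. f x) fs) i = Some (f x)"
proof -
  from assms obtain i where "i < length fs" "fs ! i = f"
    by (metis in_set_conv_nth subsetD)
  then have "lookup (map (\<lambda>f. f x) fs) i = Some (f x)" for x
    by (auto simp: lookup_def)
  then show thesis by (rule that)
qed

text \<open>Each branch has to be correct only on the inputs that reach it; this is how a tree gains
  knowledge about its input.\<close>

lemma computes_test:
  assumes "f \<in> S"
    and "computes {x\<in>X. f x = 0} S c gs" and "computes {x\<in>X. f x \<noteq> 0} S c gs"
  shows "computes X S (Suc c) gs"
  unfolding computes_def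
proof (intro allI impI)
  fix fs assume S: "S \<subseteq> set fs"
  obtain i where i: "\<And>x. lookup (map (\<lambda>f. f x) fs) i = Some (f x)"
    using lookup_state[OF assms(1) S] by blast
  obtain t where
    t: "\<And>x. x \<in> X \<Longrightarrow> f x = 0 \<Longrightarrow>
      \<exists>n\<le>c. run K G t (map (\<lambda>f. f x) fs) = Some (map (\<lambda>g. g x) gs, n)"
    using assms(2) S unfolding computes_def by blast
  obtain u where
    u: "\<And>x. x \<in> X \<Longrightarrow> f x \<noteq> 0 \<Longrightarrow>
      \<exists>n\<le>c. run K G u (map (\<lambda>f. f x) fs) = Some (map (\<lambda>g. g x) gs, n)"
    using assms(3) S unfolding computes_def by blast
  have "\<exists>n\<le>Suc c. run K G (If_Zero i t u) (map (\<lambda>f. f x) fs) = Some (map (\<lambda>g. g x) gs, n)"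
    if "x \<in> X" for x
    using t[OF that] u[OF that] i[of x] by (cases "f x = 0") auto
  then show "\<exists>t. \<forall>x\<in>X. \<exists>n\<le>Suc c.
      run K G t (map (\<lambda>f. f x) fs) = Some (map (\<lambda>g. g x) gs, n)"
    by blast
qed

text \<open>
  Stated in continuation-passing style, so that costs of consecutive computations add up and no
  operand positions appear.
\<close>

definition derives :: "('x \<Rightarrow> 'a) set \<Rightarrow> nat \<Rightarrow> ('x \<Rightarrow> 'a) set \<Rightarrow> bool" where
  "derives S c Q \<longleftrightarrow> (\<forall>X S' c' gs. S \<subseteq> S' \<longrightarrow> computes X (S' \<union> Q) c' gs \<longrightarrow>
     computes X S' (c + c') gs)"

lemma derivesD: "derives S c Q \<Longrightarrow> computes X (S \<union> Q) c' gs \<Longrightarrow> computes X S (c + c') gs"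
  unfolding derives_def by blast

lemma derives_subset: "Q \<subseteq> S \<Longrightarrow> derives S c Q"
  unfolding derives_def by (auto simp: sup.absorb1 elim: computes_mono)

lemma derives_mono:
  assumes "derives S c Q" "S \<subseteq> S'" "c \<le> c'" "Q' \<subseteq> Q"
  shows "derives S' c' Q'"
  unfolding derives_def
proof (intro allI impI)
  fix X T d gs assume "S' \<subseteq> T" "computes X (T \<union> Q') d gs"
  then have "computes X (T \<union> Q) d gs"
    using assms(4) by (auto elim: computes_mono)
  then have "computes X T (c + d) gs"
    using assms(1,2) \<open>S' \<subseteq> T\<close> unfolding derives_def by blast
  then show "computes X T (c' + d) gs"
    using assms(3) by (auto elim: computes_mono)
qed

lemma derives_trans:
  assumes "derives S c Q" "derives (S \<union> Q) c' Q'"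
  shows "derives S (c + c') (Q \<union> Q')"
  unfolding derives_def
proof (intro allI impI)
  fix X T d gs assume T: "S \<subseteq> T" and "computes X (T \<union> (Q \<union> Q')) d gs"
  then have "computes X (T \<union> Q \<union> Q') d gs" by (simp add: Un_assoc)
  moreover have "S \<union> Q \<subseteq> T \<union> Q" using T by auto
  ultimately have "computes X (T \<union> Q) (c' + d) gs"
    using assms(2) unfolding derives_def by blast
  then show "computes X T (c + c' + d) gs"
    using assms(1) T unfolding derives_def add.assoc by blast
qed

lemma derives_UN:
  assumes "finite I" "\<And>i. i \<in> I \<Longrightarrow> derives S c (Q i)"
  shows "derives S (card I * c) (\<Union>i\<in>I. Q i)"
  using assms
proof (induction I)
  case empty
  show ?case by (rule derives_subset) simp
next
  case (insert i I)
  have "derives S (c + card I * c) (Q i \<union> (\<Union>i\<in>I. Q i))"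
    by (rule derives_trans) (use insert in \<open>auto intro: derives_mono\<close>)
  then show ?case using insert by simp
qed

lemma derives_operation:
  assumes "\<And>fs. S \<subseteq> set fs \<Longrightarrow> \<exists>f. \<forall>x. exec K G f (map (\<lambda>f. f x) fs) = Some (h x)"
  shows "derives S 1 {h}"
  unfolding derives_def
proof (intro allI impI)
  fix X T d gs assume "S \<subseteq> T" "computes X (T \<union> {h}) d gs"
  then show "computes X T (1 + d) gs"
    using computes_operation[of X h T d gs] assms by auto
qed

lemma derives_const: "\<kappa> \<in> K \<Longrightarrow> derives S 1 {\<lambda>_. \<kappa>}"
  by (rule derives_operation) (rule exI[of _ "Const \<kappa>"], simp)

lemma derives_binary:
  assumes "f \<in> S" "g \<in> S"
    and "\<And>i j xs x y. lookup xs i = Some x \<Longrightarrow> lookup xs j = Some y \<Longrightarrow>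
      exec K G (c i j) xs = Some (op x y)"
  shows "derives S 1 {\<lambda>x. op (f x) (g x)}"
proof (rule derives_operation)
  fix fs assume S: "S \<subseteq> set fs"
  obtain i where "\<And>x. lookup (map (\<lambda>f. f x) fs) i = Some (f x)"
    using lookup_state[OF assms(1) S] by blast
  moreover obtain j where "\<And>x. lookup (map (\<lambda>f. f x) fs) j = Some (g x)"
    using lookup_state[OF assms(2) S] by blast
  ultimately show "\<exists>h. \<forall>x. exec K G h (map (\<lambda>f. f x) fs) = Some (op (f x) (g x))"
    using assms(3) by blast
qed

lemma derives_add: "f \<in> S \<Longrightarrow> g \<in> S \<Longrightarrow> derives S 1 {\<lambda>x. f x + g x}"
  by (rule derives_binary[where c = Add]) auto

lemma derives_mult: "f \<in> S \<Longrightarrow> g \<in> S \<Longrightarrow> derives S 1 {\<lambda>x. f x * g x}"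
  by (rule derives_binary[where c = Mul]) auto

lemma derives_add_scaled:
  assumes "f \<in> S" "g \<in> S" "\<kappa> \<in> K"
  shows "derives S 3 {\<lambda>x. f x + \<kappa> * g x}"
proof -
  have "derives S 1 {\<lambda>_. \<kappa>}"
    using assms by (intro derives_const)
  moreover have "derives (S \<union> {\<lambda>_. \<kappa>}) 1 {\<lambda>x. \<kappa> * g x}"
    using assms by (intro derives_mult) auto
  ultimately have "derives S (1 + 1) ({\<lambda>_. \<kappa>} \<union> {\<lambda>x. \<kappa> * g x})"
    by (rule derives_trans)
  moreover have "derives (S \<union> ({\<lambda>_. \<kappa>} \<union> {\<lambda>x. \<kappa> * g x})) 1 {\<lambda>x. f x + \<kappa> * g x}"
    using assms by (intro derives_add) auto
  ultimately have "derives S (1 + 1 + 1) ({\<lambda>_. \<kappa>} \<union> {\<lambda>x. \<kappa> * g x} \<union> {\<lambda>x. f x + \<kappa> * g x})"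
    by (rule derives_trans)
  then show ?thesis
    by (rule derives_mono) auto
qed

text \<open>One step for the initial zero, then three per term: load the constant, multiply,
  add.\<close>

lemma derives_lincomb:
  assumes "finite J" "\<And>j. j \<in> J \<Longrightarrow> f j \<in> S" "\<And>j. j \<in> J \<Longrightarrow> \<kappa> j \<in> K"
  shows "derives S (3 * card J + 1) {\<lambda>x. \<Sum>j\<in>J. \<kappa> j * f j x}"
  using assms
proof (induction J)
  case empty
  show ?case using derives_const[of 0 S] by simp
next
  case (insert j J)
  let ?h = "\<lambda>x. \<Sum>j\<in>J. \<kappa> j * f j x"
  have "derives S (3 * card J + 1) {?h}"
    using insert by simp
  moreover have "derives (S \<union> {?h}) 3 {\<lambda>x. ?h x + \<kappa> j * f j x}"
    using insert by (intro derives_add_scaled) auto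
  ultimately have "derives S (3 * card J + 1 + 3) ({?h} \<union> {\<lambda>x. ?h x + \<kappa> j * f j x})"
    by (rule derives_trans)
  then show ?case
    by (rule derives_mono) (use insert in \<open>auto simp: add.commute\<close>)
qed

text \<open>\<open>f\<close> is compared with the elements of \<open>F\<close> in turn. A comparison
  costs 5: one for the constant 1, three for the difference \<open>?g\<close>, one for the
  test.\<close>

lemma computes_finite_cases:
  assumes "finite F" "F \<subseteq> K" "f \<in> S"
    and "\<And>x. x \<in> X \<Longrightarrow> f x \<in> F"
    and "\<And>\<kappa>. \<kappa> \<in> F \<Longrightarrow> computes {x\<in>X. f x = \<kappa>} S c gs"
  shows "computes X S (5 * card F + c) gs"
  using assms
proof (induction F arbitrary: X)
  case empty
  then show ?case by (auto simp: computes_def)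
next
  case (insert \<kappa> F)
  let ?g = "\<lambda>x. f x + (- \<kappa>) * 1"
  let ?T = "S \<union> {\<lambda>_. 1} \<union> {?g}"
  have 1: "computes {x\<in>X. f x = \<kappa>} S c gs"
    by (rule insert.prems(4)) simp
  have "computes {x\<in>X. f x \<noteq> \<kappa>} S (5 * card F + c) gs"
  proof (rule insert.IH)
    fix \<kappa>' assume "\<kappa>' \<in> F"
    then have "computes {x\<in>X. f x = \<kappa>'} S c gs"
      by (intro insert.prems(4)) simp
    then show "computes {x \<in> {x \<in> X. f x \<noteq> \<kappa>}. f x = \<kappa>'} S c gs"
      by (rule computes_mono) auto
  qed (use insert.prems(1-3) in auto)
  then have "computes {x\<in>X. f x \<noteq> \<kappa>} ?T (5 * card F + c) gs"
    by (rule computes_mono) auto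
  moreover have "computes {x\<in>X. f x = \<kappa>} ?T (5 * card F + c) gs"
    using 1 by (rule computes_mono) auto
  ultimately have "computes X ?T (Suc (5 * card F + c)) gs"
    by (intro computes_test[of ?g]) simp_all
  moreover have "derives S (1 + 3) ({\<lambda>_. 1} \<union> {?g})"
    by (rule derives_trans[OF derives_const derives_add_scaled])
      (use insert.prems(1,2) in \<open>auto intro: uminus_closed\<close>)
  ultimately have "computes X S (1 + 3 + Suc (5 * card F + c)) gs"
    unfolding Un_assoc by (rule derivesD[rotated])
  then show ?case
    using insert.hyps by (simp add: add_ac)
qed

text \<open>The number of leaves may be exponential in \<open>length fs\<close>, but the cost counts
  a single path, so \<open>c\<close> is paid once. \<open>v\<close> records the outcomes along the
  path.\<close>

lemma computes_finite_cases_list: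
  assumes F: "finite F" "F \<subseteq> K" and fs: "set fs \<subseteq> S"
    and "\<And>x f. x \<in> X \<Longrightarrow> f \<in> set fs \<Longrightarrow> f x \<in> F"
    and "\<And>v. computes {x\<in>X. \<forall>f\<in>set fs. f x = v f} S c gs"
  shows "computes X S (length fs * (5 * card F) + c) gs"
  using assms(3-)
proof (induction fs arbitrary: X)
  case Nil
  then show ?case by simp
next
  case (Cons f fs)
  have "computes X S (5 * card F + (length fs * (5 * card F) + c)) gs"
  proof (rule computes_finite_cases[OF F])
    fix \<kappa>
    show "computes {x\<in>X. f x = \<kappa>} S (length fs * (5 * card F) + c) gs"
    proof (rule Cons.IH)
      fix v
      show "computes {x \<in> {x\<in>X. f x = \<kappa>}. \<forall>g\<in>set fs. g x = v g} S c gs"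
        by (rule computes_mono[OF Cons.prems(3)[of "v(f := \<kappa>)"]]) auto
    qed (use Cons.prems in auto)
  qed (use Cons.prems in auto)
  then show ?case by (simp add: add_ac)
qed

lemma complexity_le:
  assumes "computes X (set fs) c gs"
  shows "complexity K G ((\<lambda>x. (map (\<lambda>f. f x) fs, map (\<lambda>g. g x) gs)) ` X) \<le> enat c"
proof -
  obtain t where
    t: "\<And>x. x \<in> X \<Longrightarrow> \<exists>n\<le>c. run K G t (map (\<lambda>f. f x) fs) = Some (map (\<lambda>g. g x) gs, n)"
    using assms unfolding computes_def by blast
  let ?P = "(\<lambda>x. (map (\<lambda>f. f x) fs, map (\<lambda>g. g x) gs)) ` X"
  have "solves K G t ?P"
    unfolding solves_def using t by fastforce
  then have "complexity K G ?P \<le> worst_case_cost K G t ?P"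
    unfolding complexity_def by (intro INF_lower) simp
  also have "\<dots> \<le> enat c"
    unfolding worst_case_cost_def using t by (intro SUP_least) fastforce
  finally show ?thesis .
qed

section \<open>Multiplication modulo products of sparse polynomials\<close>

definition coeffs_below :: "nat \<Rightarrow> ('x \<Rightarrow> 'a poly) \<Rightarrow> ('x \<Rightarrow> 'a) set" where
  "coeffs_below n A = (\<lambda>i x. coeff (A x) i) ` {..<n}"

lemma coeffs_belowI: "i < n \<Longrightarrow> (\<lambda>x. coeff (A x) i) \<in> coeffs_below n A"
  by (auto simp: coeffs_below_def)

lemma coeffs_below_UN: "coeffs_below n A = (\<Union>i\<in>{..<n}. {\<lambda>x. coeff (A x) i})"
  by (auto simp: coeffs_below_def)

definition sparse :: "nat \<Rightarrow> 'a poly \<Rightarrow> bool" where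
  "sparse t V \<longleftrightarrow> (\<forall>i. coeff V i \<in> K) \<and> card {i. coeff V i \<noteq> 0} \<le> t"

text \<open>Each coefficient of the product combines at most \<open>t\<close> coefficients of
  \<open>A\<close> with constant weights, and only those of index up to its own occur.\<close>

lemma derives_mult_sparse:
  assumes V: "sparse t V" and S: "coeffs_below n A \<subseteq> S"
  shows "derives S (n * (3 * t + 1)) (coeffs_below n (\<lambda>x. A x * V))"
proof -
  have "derives S (3 * t + 1) {\<lambda>x. coeff (A x * V) i}" if i: "i < n" for i
  proof -
    let ?J = "{j. coeff V j \<noteq> 0} \<inter> {..i}"
    have "derives S (3 * card ?J + 1) {\<lambda>x. \<Sum>j\<in>?J. coeff V j * coeff (A x) (i - j)}"
    proof (rule derives_lincomb)
      fix j
      have "(\<lambda>x. coeff (A x) (i - j)) \<in> coeffs_below n A"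
        using i by (intro coeffs_belowI) auto
      then show "(\<lambda>x. coeff (A x) (i - j)) \<in> S"
        using S by blast
    qed (use V in \<open>auto simp: sparse_def\<close>)
    moreover have "(\<Sum>j\<in>?J. coeff V j * coeff (A x) (i - j)) = coeff (A x * V) i" for x
      unfolding mult.commute[of "A x"] coeff_mult by (rule sum.mono_neutral_left) auto
    moreover have "card ?J \<le> t"
      using card_mono[OF finite_support, of ?J V] V by (auto simp: sparse_def)
    ultimately show ?thesis
      by (simp) (erule derives_mono, auto)
  qed
  then have "derives S (card {..<n} * (3 * t + 1)) (coeffs_below n (\<lambda>x. A x * V))"
    unfolding coeffs_below_UN by (intro derives_UN) auto
  then show ?thesis by simp
qed

text \<open>Schoolbook division: each of the \<open>n\<close> rounds removes the top coefficient, at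
  3 operations per nonzero coefficient of \<open>V\<close>.\<close>

lemma derives_mod_sparse:
  assumes V: "sparse t V" "degree V = l" "lead_coeff V = 1"
    and deg: "\<And>x. degree (A x) < l + n"
    and S: "coeffs_below (l + n) A \<subseteq> S"
  shows "derives S (n * (3 * t)) (coeffs_below l (\<lambda>x. A x mod V))"
  using deg S
proof (induction n arbitrary: A S)
  case 0
  then have "(\<lambda>x. A x mod V) = A"
    using V by (auto simp: mod_poly_less)
  then show ?case using 0 by (auto intro: derives_subset)
next
  case (Suc n)
  \<comment> \<open>One division step. It cancels index \<open>l + n\<close> because
    \<open>V\<close> is monic, and alters only indices \<open>n + i\<close> where \<open>V\<close>
    has a nonzero coefficient at \<open>i\<close>.\<close>
  define B where "B = (\<lambda>x. A x - monom (coeff (A x) (l + n)) n * V)"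
  let ?I = "{i. coeff V i \<noteq> 0}"
  let ?Q = "\<Union>i\<in>?I. {\<lambda>x. coeff (A x) (n + i) + (- coeff V i) * coeff (A x) (l + n)}"
  have I: "i \<le> l" if "i \<in> ?I" for i
    using that V by (auto intro: le_degree)
  have A: "(\<lambda>x. coeff (A x) i) \<in> S" if "i \<le> l + n" for i
    using Suc.prems(2) coeffs_belowI[of i "l + Suc n" A] that by auto
  have "derives S (card ?I * 3) ?Q"
    using V I by (intro derives_UN finite_support derives_add_scaled A)
      (auto simp: sparse_def intro: uminus_closed)
  then have Q: "derives S (3 * t) ?Q"
    by (rule derives_mono) (use V in \<open>auto simp: sparse_def\<close>)
  have coeff_B: "coeff (B x) i =
      (if i < n then coeff (A x) i else coeff (A x) i - coeff V (i - n) * coeff (A x) (l + n))" for x i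
    by (simp add: B_def coeff_monom_mult)
  have "coeff (B x) i = 0" if "i \<ge> l + n" for i x
  proof (cases "i = l + n")
    case True
    then show ?thesis using V by (simp add: coeff_B)
  next
    case False
    then have "coeff (A x) i = 0"
      using Suc.prems(1)[of x] that by (intro coeff_eq_0) auto
    moreover have "coeff V (i - n) = 0"
      using V False that by (intro coeff_eq_0) auto
    ultimately show ?thesis by (simp add: coeff_B)
  qed
  \<comment> \<open>No degree is below 0, so \<open>l + n = 0\<close> is out of reach of the
    induction hypothesis; there the conclusion concerns no coefficients.\<close>
  show ?case
  proof (cases "l = 0 \<and> n = 0")
    case True
    then show ?thesis by (simp add: coeffs_below_def derives_subset)
  next
    case False
    then have deg_B: "degree (B x) < l + n" for x
      using \<open>\<And>i x. i \<ge> l + n \<Longrightarrow> coeff (B x) i = 0\<close> by (intro degree_lessI) auto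
    have "coeffs_below (l + n) B \<subseteq> S \<union> ?Q"
    proof
      fix f assume "f \<in> coeffs_below (l + n) B"
      then obtain i where i: "i < l + n" "f = (\<lambda>x. coeff (B x) i)"
        by (auto simp: coeffs_below_def)
      show "f \<in> S \<union> ?Q"
      proof (cases "i < n \<or> coeff V (i - n) = 0")
        case True
        then have "f = (\<lambda>x. coeff (A x) i)"
          by (auto simp: i coeff_B fun_eq_iff)
        then show ?thesis using A[of i] i by simp
      next
        case False
        then have "f = (\<lambda>x. coeff (A x) (n + (i - n)) + (- coeff V (i - n)) * coeff (A x) (l + n))"
          by (auto simp: i coeff_B fun_eq_iff)
        then show ?thesis using False by blast
      qed
    qed
    then have "derives (S \<union> ?Q) (n * (3 * t)) (coeffs_below l (\<lambda>x. B x mod V))"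
      using deg_B by (intro Suc.IH)
    moreover have "(\<lambda>x. B x mod V) = (\<lambda>x. A x mod V)"
      by (simp add: B_def poly_mod_diff_left)
    ultimately have "derives S (3 * t + n * (3 * t)) (?Q \<union> coeffs_below l (\<lambda>x. A x mod V))"
      using derives_trans[OF Q] by simp
    then show ?thesis
      by (rule derives_mono) auto
  qed
qed

lemma derives_mult_prod:
  assumes "finite D" "\<And>\<delta>. \<delta> \<in> D \<Longrightarrow> sparse t (V \<delta>)"
    and "coeffs_below n A \<subseteq> S"
  shows "derives S (card D * (n * (3 * t + 1))) (coeffs_below n (\<lambda>x. A x * prod V D))"
  using assms
proof (induction D)
  case empty
  then show ?case by (simp add: derives_subset)
next
  case (insert \<delta> D)
  let ?P = "\<lambda>x. A x * prod V D"
  have "derives (S \<union> coeffs_below n ?P) (n * (3 * t + 1)) (coeffs_below n (\<lambda>x. ?P x * V \<delta>))"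
    using insert.prems by (intro derives_mult_sparse) auto
  with insert have "derives S (card D * (n * (3 * t + 1)) + n * (3 * t + 1))
      (coeffs_below n ?P \<union> coeffs_below n (\<lambda>x. ?P x * V \<delta>))"
    by (intro derives_trans) auto
  then show ?case
    by (rule derives_mono) (use insert.hyps in \<open>auto simp: mult_ac\<close>)
qed

text \<open>One level of the recursion: reduce \<open>A\<close> modulo every
  \<open>L - [:\<delta>:]\<close>, multiply by the fixed polynomial \<open>b\<close> there through
  \<open>factor\<close>, multiply each result by the other moduli, and add up with scalar
  weights.\<close>

lemma derives_mult_mod_prod:
  fixes A :: "'x \<Rightarrow> 'a poly"
  assumes D: "finite D" "D \<noteq> {}" "D \<subseteq> K"
    and L: "degree L = l" "l > 0" "lead_coeff L = 1" "\<And>\<delta>. \<delta> \<in> D \<Longrightarrow> sparse t (L - [:\<delta>:])"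
    and factor: "\<And>\<delta> (A :: 'x \<Rightarrow> 'a poly) S. \<delta> \<in> D \<Longrightarrow> (\<And>x. degree (A x) < l) \<Longrightarrow>
      coeffs_below l A \<subseteq> S \<Longrightarrow> derives S c (coeffs_below l (\<lambda>x. A x * b mod (L - [:\<delta>:])))"
    and n: "n = card D * l"
    and A: "\<And>x. degree (A x) < n" "coeffs_below n A \<subseteq> S"
  shows "derives S (card D * (n * (3 * t) + c + 1 + card D * (n * (3 * t + 1))) + n * (3 * card D + 1))
    (coeffs_below n (\<lambda>x. A x * b mod (\<Prod>\<delta>\<in>D. L - [:\<delta>:])))"
proof -
  define V where "V = (\<lambda>\<delta>. L - [:\<delta>:])"
  define r where "r = (\<lambda>\<delta> x. A x * b mod V \<delta>)"
  define P where "P = (\<lambda>\<delta>. prod V (D - {\<delta>}))"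
  define \<kappa> where "\<kappa> = (\<lambda>\<delta>. inverse (\<Prod>\<epsilon>\<in>D - {\<delta>}. \<delta> - \<epsilon>))"
  let ?Q = "\<Union>\<delta>\<in>D. coeffs_below n (\<lambda>x. r \<delta> x * P \<delta>)"
  have card: "card D > 0" using D by (simp add: card_gt_0_iff)
  then have n_split: "n = l + (card D - 1) * l"
    using n by (cases "card D") auto
  have deg_V: "degree (V \<delta>) = l" for \<delta>
    unfolding V_def using L
    by (subst diff_conv_add_uminus, subst degree_add_eq_left) auto
  have deg_mod: "degree (B mod V \<delta>) < l" for B \<delta>
  proof -
    have "V \<delta> \<noteq> 0" using deg_V[of \<delta>] L by auto
    then show ?thesis
      using degree_mod_less'[of "V \<delta>" B] deg_V[of \<delta>] L(2)
      by (cases "B mod V \<delta> = 0") auto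
  qed
  have monic_V: "lead_coeff (V \<delta>) = 1" for \<delta>
    unfolding deg_V using L by (cases l) (auto simp: V_def)
  have \<kappa>: "\<kappa> \<delta> \<in> K" if "\<delta> \<in> D" for \<delta>
    unfolding \<kappa>_def using that D(3) by (intro inverse_closed prod_closed diff_closed) auto
  have "derives S (n * (3 * t) + c + 1 + card D * (n * (3 * t + 1))) (coeffs_below n (\<lambda>x. r \<delta> x * P \<delta>))"
    if \<delta>: "\<delta> \<in> D" for \<delta>
  proof -
    let ?M = "\<lambda>x. A x mod V \<delta>"
    let ?S1 = "S \<union> coeffs_below l ?M"
    let ?S2 = "S \<union> (coeffs_below l ?M \<union> coeffs_below l (r \<delta>))"
    let ?S3 = "S \<union> (coeffs_below l ?M \<union> coeffs_below l (r \<delta>) \<union> {\<lambda>_. 0})"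
    have 1: "derives S ((card D - 1) * l * (3 * t)) (coeffs_below l ?M)"
      using A L(4)[OF \<delta>] n_split
      by (intro derives_mod_sparse deg_V monic_V) (auto simp: V_def)
    have "derives ?S1 c (coeffs_below l (\<lambda>x. ?M x * b mod V \<delta>))"
      using deg_mod unfolding V_def by (intro factor \<delta>) auto
    moreover have "(\<lambda>x. ?M x * b mod V \<delta>) = r \<delta>"
      by (simp add: r_def mod_mult_left_eq)
    ultimately have 2: "derives S ((card D - 1) * l * (3 * t) + c)
        (coeffs_below l ?M \<union> coeffs_below l (r \<delta>))"
      using derives_trans[OF 1] by simp
    have 3: "derives ?S2 1 {\<lambda>_. 0}"
      by (rule derives_const) simp
    \<comment> \<open>A remainder has at most \<open>l\<close> nonzero coefficients, while the
      products ask for \<open>n\<close> of them; the constant 0 supplies the rest.\<close>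
    have "coeffs_below n (r \<delta>) \<subseteq> ?S3"
    proof
      fix f assume "f \<in> coeffs_below n (r \<delta>)"
      then obtain i where i: "f = (\<lambda>x. coeff (r \<delta> x) i)"
        by (auto simp: coeffs_below_def)
      show "f \<in> ?S3"
      proof (cases "i < l")
        case True
        then show ?thesis using i by (auto intro: coeffs_belowI)
      next
        case False
        have "degree (r \<delta> x) < l" for x
          unfolding r_def by (rule deg_mod)
        then have "f = (\<lambda>_. 0)"
          using False i by (auto intro!: coeff_eq_0 less_le_trans[of _ l i])
        then show ?thesis by simp
      qed
    qed
    then have "derives ?S3 (card (D - {\<delta>}) * (n * (3 * t + 1))) (coeffs_below n (\<lambda>x. r \<delta> x * P \<delta>))"
      unfolding P_def using D L by (intro derives_mult_prod) (auto simp: V_def)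
    from derives_trans[OF derives_trans[OF 2 3] this] show ?thesis
    proof (rule derives_mono)
      have "(card D - 1) * l \<le> n" using n_split by simp
      moreover have "card (D - {\<delta>}) \<le> card D"
        using D by (simp add: card_mono)
      ultimately show "(card D - 1) * l * (3 * t) + c + 1 + card (D - {\<delta>}) * (n * (3 * t + 1))
          \<le> n * (3 * t) + c + 1 + card D * (n * (3 * t + 1))"
        by (intro add_mono mult_right_mono) auto
    qed auto
  qed
  with D have Q: "derives S (card D * (n * (3 * t) + c + 1 + card D * (n * (3 * t + 1)))) ?Q"
    by (intro derives_UN)
  have result: "A x * b mod prod V D = (\<Sum>\<delta>\<in>D. smult (\<kappa> \<delta>) (r \<delta> x * P \<delta>))" for x
    unfolding \<kappa>_def r_def P_def V_def
    by (rule crt_combination[symmetric]) (use D L in auto)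
  have "derives (S \<union> ?Q) (3 * card D + 1) {\<lambda>x. coeff (A x * b mod prod V D) i}" if i: "i < n" for i
  proof -
    have "derives (S \<union> ?Q) (3 * card D + 1) {\<lambda>x. \<Sum>\<delta>\<in>D. \<kappa> \<delta> * coeff (r \<delta> x * P \<delta>) i}"
    proof (rule derives_lincomb)
      fix \<delta> assume \<delta>: "\<delta> \<in> D"
      show "(\<lambda>x. coeff (r \<delta> x * P \<delta>) i) \<in> S \<union> ?Q"
        using \<delta> coeffs_belowI[OF i, of "\<lambda>x. r \<delta> x * P \<delta>"] by blast
    qed (use D \<kappa> in auto)
    then show ?thesis by (simp add: result coeff_sum)
  qed
  then have "derives (S \<union> ?Q) (card {..<n} * (3 * card D + 1))
      (coeffs_below n (\<lambda>x. A x * b mod prod V D))"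
    unfolding coeffs_below_UN[of n "\<lambda>x. A x * b mod prod V D"] by (intro derives_UN) auto
  from derives_trans[OF Q this] show ?thesis
    unfolding V_def by (rule derives_mono) auto
qed

end

section \<open>Linearized moduli\<close>

locale q_field =
  fixes q e m :: nat and K :: "'a::alg_closed_field set" and G :: "('a \<Rightarrow> 'a) set"
  assumes prime_char: "prime CHAR('a)" and e_pos: "e > 0" and m_pos: "m > 0"
    and q_def: "q = CHAR('a) ^ e" and K_def: "K = GF (q ^ m)"
begin

lemma q_gt_1: "q > 1"
  using prime_gt_1_nat[OF prime_char] e_pos unfolding q_def by (rule one_less_power)

lemma q_power: "q ^ i = CHAR('a) ^ (e * i)"
  by (simp add: q_def power_mult)

lemma frobenius_add: "(x + y :: 'a) ^ (q ^ i) = x ^ (q ^ i) + y ^ (q ^ i)"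
  by (rule freshmans_dream'[OF prime_char q_power])

lemma frobenius_sum: "(sum f I :: 'a) ^ (q ^ i) = (\<Sum>j\<in>I. f j ^ (q ^ i))"
  by (rule freshmans_dream_sum'[OF prime_char q_power])

lemma frobenius_diff: "(x - y :: 'a) ^ (q ^ i) = x ^ (q ^ i) - y ^ (q ^ i)"
  using frobenius_add[of "x - y" y i] by simp

lemma frobenius_poly_sum: "(sum f I :: 'a poly) ^ q = (\<Sum>j\<in>I. f j ^ q)"
  by (rule freshmans_dream_sum'[where n = e]) (simp_all add: prime_char q_def)

lemma card_GF_q: "card (GF (q ^ i) :: 'a set) = q ^ i" if "i > 0"
  unfolding q_power using that e_pos by (intro card_GF prime_char) simp

lemma card_GF_q1: "card (GF q :: 'a set) = q"
  using card_GF_q[of 1] by simp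

lemma GF_power_mono: "GF (q ^ i) \<subseteq> (GF (q ^ (i * j)) :: 'a set)"
proof -
  have "x ^ (q ^ (i * j)) = x" if "x ^ (q ^ i) = x" for x :: 'a
    by (induction j) (use that in \<open>simp_all add: power_add power_mult\<close>)
  then show ?thesis by (auto simp: GF_def)
qed

lemma card_K: "card K = q ^ m"
  unfolding K_def by (rule card_GF_q[OF m_pos])

lemma finite_K: "finite K"
  using card_K q_gt_1 by (metis card.infinite not_one_less_zero power_eq_0_iff)

lemma GF_subset_K: "s dvd m \<Longrightarrow> GF (q ^ s) \<subseteq> K"
  using GF_power_mono[of s] by (auto simp: K_def elim!: dvdE)

lemma GF_q_subset_K: "GF q \<subseteq> K"
  using GF_subset_K[of 1] by simp

sublocale subfield K G
proof
  fix x y :: 'a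
  assume "x \<in> K"
  then show "- x \<in> K"
    using frobenius_diff[of 0 x m] q_gt_1 by (simp add: K_def GF_def power_0_left)
  assume "y \<in> K"
  with \<open>x \<in> K\<close> show "x + y \<in> K" "x * y \<in> K"
    by (simp_all add: K_def GF_def frobenius_add power_mult_distrib)
qed (use q_gt_1 in \<open>simp_all add: K_def GF_def power_inverse power_0_left\<close>)

section \<open>Cost recurrence of the multiplication\<close>

text \<open>A closed-form bound for the recurrence of \<open>derives_mult_mod_prod\<close> with
  \<open>q\<close> factors of degree \<open>q ^ k\<close>. The square arises from summing overheads
  that grow linearly with the level.\<close>

definition mult_cost :: "nat \<Rightarrow> nat" where
  "mult_cost k = q ^ k * (4 + 12 * q\<^sup>2 * (k + 1)\<^sup>2)"

text \<open>With \<open>n = q ^ Suc k\<close> and \<open>t = k + 2\<close> the overhead is at most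
  \<open>12 * q\<^sup>2 * n * t\<close>, and the squares of \<open>k + 2\<close> and
  \<open>k + 1\<close> differ by \<open>2 * k + 3\<close>, which is at least
  \<open>t\<close>.\<close>

lemma mult_cost_Suc:
  "q * (q ^ Suc k * (3 * (k + 2)) + mult_cost k + 1 + q * (q ^ Suc k * (3 * (k + 2) + 1)))
     + q ^ Suc k * (3 * q + 1) \<le> mult_cost (Suc k)"
proof -
  define n where "n = q ^ Suc k"
  define t where "t = k + 2"
  have n: "n \<ge> 1" and t: "t \<ge> 1" and q: "q \<ge> 1"
    using q_gt_1 by (auto simp: n_def t_def)
  have bound: "a * b * c \<le> q\<^sup>2 * n * t" if "a \<le> q\<^sup>2" "b \<le> n" "c \<le> t" for a b c
    using that by (intro mult_mono) auto
  have q2: "q \<le> q\<^sup>2" "1 \<le> q\<^sup>2"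
    using q by (simp_all add: power2_eq_square)
  have "q * n * t \<le> q\<^sup>2 * n * t" "q * 1 * 1 \<le> q\<^sup>2 * n * t" "q\<^sup>2 * n * 1 \<le> q\<^sup>2 * n * t"
    "q * n * 1 \<le> q\<^sup>2 * n * t" "1 * n * 1 \<le> q\<^sup>2 * n * t"
    using q2 n t by (intro bound; simp)+
  then have "3 * (q * n * t) + q + 3 * (q\<^sup>2 * n * t) + q\<^sup>2 * n + 3 * (q * n) + n \<le> 12 * (q\<^sup>2 * n * t)"
    by linarith
  moreover have "q * (n * (3 * t) + mult_cost k + 1 + q * (n * (3 * t + 1))) + n * (3 * q + 1) =
      n * (4 + 12 * q\<^sup>2 * (k + 1)\<^sup>2) + (3 * (q * n * t) + q + 3 * (q\<^sup>2 * n * t) + q\<^sup>2 * n + 3 * (q * n) + n)"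
    by (simp add: mult_cost_def n_def algebra_simps power2_eq_square)
  moreover have "n * (4 + 12 * q\<^sup>2 * (k + 1)\<^sup>2) + 12 * (q\<^sup>2 * n * t) \<le> mult_cost (Suc k)"
    by (simp add: mult_cost_def n_def t_def algebra_simps power2_eq_square)
  ultimately show ?thesis
    unfolding n_def t_def by linarith
qed

section \<open>A tower of linearized polynomials\<close>

definition linearized_modulus :: "nat \<Rightarrow> 'a poly \<Rightarrow> bool" where
  "linearized_modulus k L \<longleftrightarrow> degree L = q ^ k \<and> lead_coeff L = 1 \<and>
     (\<exists>l. L = (\<Sum>i\<le>k. monom (l i) (q ^ i)) \<and> (\<forall>i. l i \<in> K))"

text \<open>Nonzero coefficients can sit only at the \<open>k + 1\<close> exponents
  \<open>q ^ i\<close> and at 0.\<close>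

lemma linearized_modulus_sparse:
  assumes "linearized_modulus k L" "d \<in> K"
  shows "sparse (k + 2) (L - [:d:])"
proof -
  obtain l where L: "L = (\<Sum>i\<le>k. monom (l i) (q ^ i))" and l: "\<And>i. l i \<in> K"
    using assms unfolding linearized_modulus_def by blast
  have "coeff (L - [:d:]) i \<in> K" for i
    using assms(2) l unfolding L
    by (auto simp: coeff_sum coeff_pCons split: nat.split intro!: diff_closed sum_closed)
  moreover have "{i. coeff (L - [:d:]) i \<noteq> 0} \<subseteq> insert 0 ((\<lambda>i. q ^ i) ` {..k})"
  proof -
    have "coeff (L - [:d:]) i = 0" if "i \<noteq> 0" "i \<notin> (\<lambda>i. q ^ i) ` {..k}" for i
    proof -
      have "coeff L i = 0"
        using that(2) unfolding L by (auto simp: coeff_sum intro!: sum.neutral)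
      moreover have "coeff [:d:] i = 0"
        using that(1) by (cases i) auto
      ultimately show ?thesis by simp
    qed
    then show ?thesis by blast
  qed
  then have "card {i. coeff (L - [:d:]) i \<noteq> 0} \<le> card (insert 0 ((\<lambda>i. q ^ i) ` {..k}))"
    by (intro card_mono) auto
  moreover have "card (insert 0 ((\<lambda>i. q ^ i) ` {..k})) \<le> Suc (Suc k)"
    using card_image_le[of "{..k}" "\<lambda>i. q ^ i"]
    by (intro order_trans[OF card_insert_le_m1[of "Suc (Suc k)"]]) auto
  ultimately show ?thesis by (simp add: sparse_def)
qed

text \<open>Powers of Frobenius are additive and fix \<open>c\<close>, so evaluating
  \<open>L\<close> is linear over \<open>GF q\<close>.\<close>

lemma linearized_modulus_add:
  assumes "linearized_modulus k L" "c \<in> GF q"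
  shows "poly L (u + c * v) = poly L u + c * poly L v"
proof -
  obtain l where L: "L = (\<Sum>i\<le>k. monom (l i) (q ^ i))"
    using assms unfolding linearized_modulus_def by blast
  have "c ^ (q ^ i) = c" for i
    using GF_power_mono[of 1 i] assms(2) by (auto simp: GF_def)
  then show ?thesis
    by (simp add: L poly_sum poly_monom frobenius_add power_mult_distrib algebra_simps
        sum.distrib sum_distrib_left)
qed

lemma linearized_modulus_closed:
  assumes "linearized_modulus k L" "u \<in> K"
  shows "poly L u \<in> K"
proof -
  obtain l where "L = (\<Sum>i\<le>k. monom (l i) (q ^ i))" "\<And>i. l i \<in> K"
    using assms unfolding linearized_modulus_def by blast
  with assms(2) show ?thesis
    by (auto simp: poly_sum poly_monom intro!: sum_closed mult_closed power_closed)
qed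

text \<open>Raising to the power \<open>q\<close> is additive on polynomials and moves the exponent
  \<open>q ^ i\<close> to \<open>q ^ Suc i\<close>, so the result is again linearized.\<close>

lemma linearized_modulus_step:
  assumes L: "linearized_modulus k L" and w: "w \<in> K"
  defines "L' \<equiv> L ^ q - smult (w ^ (q - 1)) L"
  shows "linearized_modulus (Suc k) L'"
proof -
  obtain l where L_sum: "L = (\<Sum>i\<le>k. monom (l i) (q ^ i))" and l: "\<And>i. l i \<in> K"
    using L unfolding linearized_modulus_def by blast
  have deg_L: "degree L = q ^ k" and lead_L: "lead_coeff L = 1"
    using L by (auto simp: linearized_modulus_def)
  define r where "r = smult (w ^ (q - 1)) L"
  have L'_eq: "L' = L ^ q - r"
    by (simp add: L'_def r_def)
  have "degree r \<le> q ^ k"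
    using degree_smult_le[of "w ^ (q - 1)" L] deg_L unfolding r_def by simp
  also have "q ^ k < q ^ Suc k"
    using q_gt_1 by simp
  finally have less: "degree r < q ^ Suc k" .
  have nz: "L \<noteq> 0" using lead_L by auto
  have deg_Lq: "degree (L ^ q) = q ^ Suc k"
    using nz by (simp add: degree_power_eq deg_L)
  have deg: "degree L' = q ^ Suc k"
    unfolding L'_eq diff_conv_add_uminus using less deg_Lq
    by (subst degree_add_eq_left) simp_all
  have "lead_coeff (L ^ q) = 1"
    by (simp add: lead_coeff_power lead_L)
  then have lead: "lead_coeff L' = 1"
    unfolding deg unfolding L'_eq using less deg_Lq by (simp add: coeff_eq_0)
  define l' where "l' i = (if i = 0 then 0 else l (i - 1) ^ q) - (if i \<le> k then w ^ (q - 1) * l i else 0)"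
    for i
  have "L ^ q = (\<Sum>i\<le>k. monom (l i ^ q) (q ^ Suc i))"
    by (simp add: L_sum frobenius_poly_sum monom_power mult.commute)
  also have "\<dots> = (\<Sum>i\<le>Suc k. monom (if i = 0 then 0 else l (i - 1) ^ q) (q ^ i))"
    by (subst sum.atMost_Suc_shift) simp
  finally have 1: "L ^ q = (\<Sum>i\<le>Suc k. monom (if i = 0 then 0 else l (i - 1) ^ q) (q ^ i))" .
  have "r = (\<Sum>i\<le>Suc k. monom (if i \<le> k then w ^ (q - 1) * l i else 0) (q ^ i))"
    by (simp add: r_def L_sum smult_sum_right smult_monom)
  with 1 have "L' = (\<Sum>i\<le>Suc k. monom (l' i) (q ^ i))"
    unfolding L'_eq l'_def by (simp only: sum_subtractf flip: diff_monom)
  moreover have "l' i \<in> K" for i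
    unfolding l'_def using l w by (auto intro!: diff_closed uminus_closed power_closed mult_closed)
  ultimately show ?thesis
    unfolding linearized_modulus_def using deg lead by blast
qed

text \<open>Let \<open>w = poly L v\<close>. The polynomial
  \<open>X ^ q - w ^ (q - 1) * X - poly L' u\<close> has the \<open>q\<close> roots
  \<open>poly L u + c * w\<close> with \<open>c\<close> in \<open>GF q\<close>; substituting
  \<open>L\<close> for \<open>X\<close> gives the factorization. By linearity each root is the value
  of \<open>L\<close> at \<open>u + c * v\<close>, which keeps the constants in the image of
  \<open>K\<close> for the next level.\<close>

lemma linearized_modulus_factor:
  assumes L: "linearized_modulus k L" and u: "u \<in> K" and v: "v \<in> K" "poly L v \<noteq> 0"
  defines "L' \<equiv> L ^ q - smult (poly L v ^ (q - 1)) L"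
  obtains D where "finite D" "card D = q" "D \<subseteq> poly L ` K"
    "L' - [:poly L' u:] = (\<Prod>\<delta>\<in>D. L - [:\<delta>:])"
proof
  define w where "w = poly L v"
  define y where "y = poly L u"
  define D where "D = (\<lambda>c. y + c * w) ` GF q"
  have finite_GF: "finite (GF q :: 'a set)"
    using card_GF_q1 q_gt_1 by (metis card.infinite not_one_less_zero)
  then show fin: "finite D" by (simp add: D_def)
  have "inj_on (\<lambda>c. y + c * w) (GF q)"
    using v by (auto simp: inj_on_def w_def)
  then show card: "card D = q"
    by (simp add: D_def card_image card_GF_q1)
  have "y + c * w = poly L (u + c * v)" if "c \<in> GF q" for c
    using linearized_modulus_add[OF L that] by (simp add: y_def w_def)
  moreover have "u + c * v \<in> K" if "c \<in> GF q" for c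
    using that u v GF_q_subset_K by (auto intro!: add_closed mult_closed)
  ultimately show "D \<subseteq> poly L ` K"
    unfolding D_def by blast
  define r where "r = - monom (w ^ (q - 1)) 1 - [:poly L' u:]"
  define g where "g = monom 1 q + r"
  have lower: "degree r < q"
    using q_gt_1 unfolding r_def by (intro degree_diff_less) (auto intro: le_less_trans[OF degree_monom_le])
  have deg_g: "degree g = q"
    unfolding g_def using lower by (subst degree_add_eq_left) (simp_all add: degree_monom_eq)
  have lead_g: "lead_coeff g = 1"
    unfolding deg_g unfolding g_def using lower by (simp add: coeff_eq_0)
  have "poly g \<delta> = 0" if \<delta>: "\<delta> \<in> D" for \<delta>
  proof -
    from \<delta> obtain c where c: "c ^ q = c" "\<delta> = y + c * w"
      by (auto simp: D_def GF_def)
    have "w ^ q = w ^ (q - 1) * w"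
      using q_gt_1 by (metis less_trans power_minus_mult zero_less_one)
    then show ?thesis
      using frobenius_add[of y "c * w" 1] c
      by (simp add: g_def r_def L'_def poly_monom w_def[symmetric] y_def[symmetric] power_mult_distrib
          algebra_simps)
  qed
  then have "g = (\<Prod>\<delta>\<in>D. [:- \<delta>, 1:])"
    using fin card deg_g lead_g by (intro monic_eq_prod_roots) auto
  moreover have "pcompose [:- \<delta>, 1:] L = L - [:\<delta>:]" for \<delta>
    by (simp add: pcompose_pCons)
  ultimately have "pcompose g L = (\<Prod>\<delta>\<in>D. L - [:\<delta>:])"
    by (simp only: pcompose_prod)
  moreover have "pcompose (monom c n) L = smult c (L ^ n)" for c n
    by (induction n) (simp_all add: monom_0 monom_Suc pcompose_pCons)
  then have "pcompose g L = L' - [:poly L' u:]"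
    by (simp add: g_def r_def L'_def pcompose_add pcompose_diff pcompose_uminus w_def)
  ultimately show "L' - [:poly L' u:] = (\<Prod>\<delta>\<in>D. L - [:\<delta>:])" by simp
qed

text \<open>The additive FFT. One \<open>L\<close> serves all \<open>d\<close>, \<open>b\<close> and
  \<open>A\<close>. Restricting \<open>d\<close> to values of \<open>L\<close> lets
  \<open>linearized_modulus_factor\<close> split the modulus into factors of the same form, and the
  bound on \<open>q ^ k\<close> provides the nonzero value needed to build the next
  \<open>L\<close>.\<close>

lemma derives_mult_mod_linearized:
  assumes "q ^ k \<le> card K"
  shows "\<exists>L. linearized_modulus k L \<and>
    (\<forall>d\<in>poly L ` K. \<forall>b (A :: 'x \<Rightarrow> 'a poly) S. (\<forall>i. coeff b i \<in> K) \<longrightarrow>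
      (\<forall>x. degree (A x) < q ^ k) \<longrightarrow> coeffs_below (q ^ k) A \<subseteq> S \<longrightarrow>
      derives S (mult_cost k) (coeffs_below (q ^ k) (\<lambda>x. A x * b mod (L - [:d:]))))"
  using assms
proof (induction k)
  case 0
  let ?X = "monom 1 1 :: 'a poly"
  have "linearized_modulus 0 ?X"
    unfolding linearized_modulus_def
    by (auto simp: degree_monom_eq intro!: exI[of _ "\<lambda>_. 1"])
  moreover have "derives S (mult_cost 0) (coeffs_below 1 (\<lambda>x. A x * b mod (?X - [:d:])))"
    if b: "\<forall>i. coeff b i \<in> K" and A: "\<forall>x. degree (A x) < 1" "coeffs_below 1 A \<subseteq> S" and d: "d \<in> K"
    for d b and A :: "'x \<Rightarrow> 'a poly" and S
  proof -
    \<comment> \<open>Reduction modulo \<open>X - d\<close> is evaluation at \<open>d\<close>, so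
      the constant polynomial \<open>A x\<close> is just scaled by the known constant
      \<open>poly b d\<close>.\<close>
    have "?X - [:d:] = [:- d, 1:]"
      by (simp add: monom_Suc monom_0)
    moreover have "A x = [:coeff (A x) 0:]" for x
      using A(1) by (metis coeff_pCons_0 degree_eq_zeroE less_one)
    ultimately have "coeff (A x * b mod (?X - [:d:])) 0 = poly b d * coeff (A x) 0" for x
      by (simp only: mod_linear poly_mult coeff_pCons_0) (metis mult.commute poly_const_conv)
    then have eq: "coeffs_below 1 (\<lambda>x. A x * b mod (?X - [:d:])) = {\<lambda>x. poly b d * coeff (A x) 0}"
      by (simp add: coeffs_below_def lessThan_Suc)
    have "(\<lambda>x. coeff (A x) 0) \<in> S"
      using A(2) coeffs_belowI[of 0 1 A] by auto
    moreover have "poly b d \<in> K"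
      using b d by (intro poly_closed) auto
    ultimately have "derives S (3 * card {0::nat} + 1) {\<lambda>x. \<Sum>j\<in>{0::nat}. poly b d * coeff (A x) 0}"
      by (intro derives_lincomb) auto
    then show ?thesis
      unfolding eq by (rule derives_mono) (auto simp: mult_cost_def)
  qed
  ultimately show ?case
    by (intro exI[of _ ?X]) (auto simp: poly_monom)
next
  case (Suc k)
  have less: "q ^ k < q ^ Suc k" using q_gt_1 by simp
  with Suc.prems have "q ^ k \<le> card K" by linarith
  from Suc.IH[OF this] obtain L where L: "linearized_modulus k L" and
    IH: "\<And>d b (A :: 'x \<Rightarrow> 'a poly) S. d \<in> poly L ` K \<Longrightarrow> \<forall>i. coeff b i \<in> K \<Longrightarrow>
      \<forall>x. degree (A x) < q ^ k \<Longrightarrow> coeffs_below (q ^ k) A \<subseteq> S \<Longrightarrow>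
      derives S (mult_cost k) (coeffs_below (q ^ k) (\<lambda>x. A x * b mod (L - [:d:])))"
    by blast
  have deg_L: "degree L = q ^ k" and lead_L: "lead_coeff L = 1"
    using L by (auto simp: linearized_modulus_def)
  \<comment> \<open>\<open>L\<close> has degree below \<open>card K\<close>, so it cannot vanish on
    all of \<open>K\<close>.\<close>
  have "\<exists>v\<in>K. poly L v \<noteq> 0"
  proof (rule ccontr)
    assume "\<not> (\<exists>v\<in>K. poly L v \<noteq> 0)"
    moreover have "L \<noteq> 0" using lead_L by auto
    ultimately have "card K \<le> degree L"
      by (intro order_trans[OF card_mono card_poly_roots_bound] poly_roots_finite) auto
    with Suc.prems less deg_L show False by linarith
  qed
  then obtain v where v: "v \<in> K" "poly L v \<noteq> 0" by blast
  define L' where "L' = L ^ q - smult (poly L v ^ (q - 1)) L"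
  have "linearized_modulus (Suc k) L'"
    unfolding L'_def using L v by (intro linearized_modulus_step linearized_modulus_closed)
  moreover have "derives S (mult_cost (Suc k)) (coeffs_below (q ^ Suc k) (\<lambda>x. A x * b mod (L' - [:d:])))"
    if d: "d \<in> poly L' ` K" and b: "\<forall>i. coeff b i \<in> K"
      and A: "\<forall>x. degree (A x) < q ^ Suc k" "coeffs_below (q ^ Suc k) A \<subseteq> S"
    for d b and A :: "'x \<Rightarrow> 'a poly" and S
  proof -
    from d obtain u where u: "u \<in> K" "d = poly L' u" by blast
    obtain D where D: "finite D" "card D = q" "D \<subseteq> poly L ` K"
      and prod: "L' - [:d:] = (\<Prod>\<delta>\<in>D. L - [:\<delta>:])"
      using linearized_modulus_factor[OF L u(1) v] unfolding L'_def u(2) by blast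
    have D_K: "D \<subseteq> K"
      using D(3) L linearized_modulus_closed by blast
    have "derives S (card D * (q ^ Suc k * (3 * (k + 2)) + mult_cost k + 1
        + card D * (q ^ Suc k * (3 * (k + 2) + 1))) + q ^ Suc k * (3 * card D + 1))
      (coeffs_below (q ^ Suc k) (\<lambda>x. A x * b mod (\<Prod>\<delta>\<in>D. L - [:\<delta>:])))"
    proof (rule derives_mult_mod_prod[OF D(1) _ D_K deg_L _ lead_L])
      show "D \<noteq> {}" using D(2) q_gt_1 by auto
      show "0 < q ^ k" using q_gt_1 by simp
      fix \<delta> assume \<delta>: "\<delta> \<in> D"
      show "sparse (k + 2) (L - [:\<delta>:])"
        using \<delta> D_K L by (intro linearized_modulus_sparse) auto
      show "derives T (mult_cost k) (coeffs_below (q ^ k) (\<lambda>x. B x * b mod (L - [:\<delta>:])))"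
        if "\<And>x. degree (B x) < q ^ k" "coeffs_below (q ^ k) B \<subseteq> T"
        for B :: "'x \<Rightarrow> 'a poly" and T
        using \<delta> D(3) b that by (intro IH) auto
    qed (use D A in auto)
    then show ?thesis
      unfolding prod D(2) by (rule derives_mono) (rule mult_cost_Suc order_refl)+
  qed
  ultimately show ?case by blast
qed

text \<open>
  The sums are coefficients of \<open>1\<close>, \<dots>, \<open>x ^ (2 * s - 2)\<close> in a product of polynomials of
  degree less than \<open>3 * s\<close>, so reducing modulo \<open>L\<close> of degree \<open>q ^ k\<close> does not change them.
\<close>

lemma derives_hankel:
  fixes a :: "nat \<Rightarrow> 'x \<Rightarrow> 'a"
  assumes k: "3 * s \<le> q ^ k" "q ^ k \<le> card K"
    and h: "\<And>t. h t \<in> K" and S: "\<And>i. i < s \<Longrightarrow> a i \<in> S"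
  shows "derives S (mult_cost k + 1) ((\<lambda>j x. \<Sum>i<s. h (i + j) * a i x) ` {..<s})"
proof (cases "s = 0")
  case True
  then show ?thesis by (simp add: derives_subset)
next
  case False
  define A where "A = (\<lambda>x. \<Sum>i<s. monom (a i x) i)"
  \<comment> \<open>The values of \<open>h\<close> are reversed, so that in the coefficient of index
    \<open>2 * s - 2 - j\<close> the convolution pairs \<open>a i\<close> with
    \<open>h (i + j)\<close>.\<close>
  define b where "b = (\<Sum>t<2 * s - 1. monom (h (2 * s - 2 - t)) t)"
  have coeff_A: "coeff (A x) i = (if i < s then a i x else 0)" for x i
    by (simp add: A_def coeff_sum)
  have coeff_b: "coeff b t = (if t < 2 * s - 1 then h (2 * s - 2 - t) else 0)" for t
    by (simp add: b_def coeff_sum)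
  have deg_A: "degree (A x) < s" for x
    using False by (intro degree_lessI) (auto simp: coeff_A)
  have deg_b: "degree b < 2 * s - 1"
    using False by (intro degree_lessI) (auto simp: coeff_b)
  have deg_Ab: "degree (A x * b) < q ^ k" for x
    using degree_mult_le[of "A x" b] deg_A[of x] deg_b k(1) by linarith
  have coeff_Ab: "coeff (A x * b) (2 * s - 2 - j) = (\<Sum>i<s. h (i + j) * a i x)" if "j < s" for x j
  proof -
    have "coeff (A x * b) (2 * s - 2 - j) =
        (\<Sum>i\<le>2 * s - 2 - j. coeff (A x) i * coeff b (2 * s - 2 - j - i))"
      by (rule coeff_mult)
    also have "\<dots> = (\<Sum>i<s. coeff (A x) i * coeff b (2 * s - 2 - j - i))"
      using that by (intro sum.mono_neutral_right) (auto simp: coeff_A)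
    also have "\<dots> = (\<Sum>i<s. h (i + j) * a i x)"
    proof (rule sum.cong)
      fix i assume "i \<in> {..<s}"
      then have "2 * s - 2 - j - i < 2 * s - 1" "2 * s - 2 - (2 * s - 2 - j - i) = i + j" "i < s"
        using that by auto
      then show "coeff (A x) i * coeff b (2 * s - 2 - j - i) = h (i + j) * a i x"
        by (simp add: coeff_A coeff_b)
    qed simp
    finally show ?thesis .
  qed
  obtain L where L: "linearized_modulus k L" and
    mult: "\<And>d b (A :: 'x \<Rightarrow> 'a poly) S. d \<in> poly L ` K \<Longrightarrow> \<forall>i. coeff b i \<in> K \<Longrightarrow>
      \<forall>x. degree (A x) < q ^ k \<Longrightarrow> coeffs_below (q ^ k) A \<subseteq> S \<Longrightarrow>
      derives S (mult_cost k) (coeffs_below (q ^ k) (\<lambda>x. A x * b mod (L - [:d:])))"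
    using derives_mult_mod_linearized[OF k(2)] by blast
  let ?V = "L - [:poly L 0:]"
  have "degree ?V = q ^ k"
    unfolding diff_conv_add_uminus using L q_gt_1
    by (subst degree_add_eq_left) (auto simp: linearized_modulus_def)
  then have no_mod: "A x * b mod ?V = A x * b" for x
    using deg_Ab[of x] by (simp add: mod_poly_less)
  let ?S = "S \<union> {\<lambda>_. 0}"
  have "derives ?S (mult_cost k) (coeffs_below (q ^ k) (\<lambda>x. A x * b mod ?V))"
  proof (rule mult)
    show "poly L 0 \<in> poly L ` K" by simp
    show "\<forall>i. coeff b i \<in> K" using h by (simp add: coeff_b)
    show "\<forall>x. degree (A x) < q ^ k"
    proof
      fix x show "degree (A x) < q ^ k"
        using deg_A[of x] k(1) by linarith
    qed
    show "coeffs_below (q ^ k) A \<subseteq> ?S"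
    proof
      fix f assume "f \<in> coeffs_below (q ^ k) A"
      then obtain i where "f = (\<lambda>x. if i < s then a i x else 0)"
        by (auto simp: coeffs_below_def coeff_A)
      then show "f \<in> ?S"
        using S[of i] by (cases "i < s") auto
    qed
  qed
  then have "derives S (1 + mult_cost k) ({\<lambda>_. 0} \<union> coeffs_below (q ^ k) (\<lambda>x. A x * b))"
    unfolding no_mod by (intro derives_trans derives_const) simp_all
  moreover have "(\<lambda>x. \<Sum>i<s. h (i + j) * a i x) \<in> coeffs_below (q ^ k) (\<lambda>x. A x * b)" if "j < s" for j
  proof -
    have "2 * s - 2 - j < q ^ k"
      using that k(1) by linarith
    from coeffs_belowI[OF this, of "\<lambda>x. A x * b"] show ?thesis
      unfolding coeff_Ab[OF that] .
  qed
  ultimately show ?thesis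
    by (elim derives_mono) auto
qed

section \<open>Normal bases\<close>

lemma coeff_sum_monom_q:
  "coeff (\<Sum>i<s. monom (c i) (q ^ i)) (q ^ k) = (if k < s then c k else 0 :: 'a)"
proof -
  have "coeff (\<Sum>i<s. monom (c i) (q ^ i)) (q ^ k) = (\<Sum>i<s. if i = k then c i else 0)"
    using q_gt_1 by (simp add: coeff_sum)
  then show ?thesis by simp
qed

lemma frobenius_period:
  fixes \<beta> :: 'a
  assumes "\<beta> \<in> GF (q ^ s)"
  shows "\<beta> ^ (q ^ (t mod s)) = \<beta> ^ (q ^ t)"
proof -
  have "\<beta> ^ (q ^ (s * (t div s))) = \<beta>"
    using subsetD[OF GF_power_mono assms, of "t div s"] by (simp add: GF_def)
  then have "\<beta> ^ (q ^ (s * (t div s) + t mod s)) = \<beta> ^ (q ^ (t mod s))"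
    by (simp only: power_add power_mult)
  then show ?thesis by simp
qed

text \<open>A kernel vector is the coefficient vector of a linearized polynomial vanishing at all
  conjugates of \<beta>, hence on their span over \<open>GF q\<close>, which has
  \<open>q ^ s\<close> elements. Its degree is below \<open>q ^ s\<close>, so it is zero.\<close>

lemma hankel_injective:
  assumes \<beta>: "normal_basis_generator q s \<beta>" and "s > 0"
    and zero: "\<And>j. j < s \<Longrightarrow> (\<Sum>i<s. \<beta> ^ (q ^ (i + j)) * a i) = 0" and "i < s"
  shows "a i = (0 :: 'a)"
proof -
  define f where "f = (\<Sum>i<s. monom (a i) (q ^ i))"
  have "poly f x = 0" if x: "x \<in> GF (q ^ s)" for x
  proof -
    from x \<beta> obtain c where c: "\<forall>i<s. c i \<in> GF q" "x = (\<Sum>i<s. c i * \<beta> ^ (q ^ i))"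
      unfolding normal_basis_generator_def by blast
    have "x ^ (q ^ i) = (\<Sum>j<s. c j * \<beta> ^ (q ^ (i + j)))" for i
    proof -
      have "c j ^ (q ^ i) = c j" if "j < s" for j
        using c(1) that GF_power_mono[of 1 i] by (auto simp: GF_def)
      then show ?thesis
        unfolding c(2) frobenius_sum
        by (intro sum.cong) (auto simp: power_mult_distrib power_add mult.commute simp flip: power_mult)
    qed
    then have "poly f x = (\<Sum>i<s. \<Sum>j<s. a i * (c j * \<beta> ^ (q ^ (i + j))))"
      by (simp add: f_def poly_sum poly_monom sum_distrib_left)
    also have "\<dots> = (\<Sum>j<s. c j * (\<Sum>i<s. \<beta> ^ (q ^ (i + j)) * a i))"
      by (subst sum.swap) (simp add: sum_distrib_left mult_ac)
    also have "\<dots> = 0"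
      by (simp add: zero)
    finally show ?thesis .
  qed
  moreover have "degree f < q ^ s"
  proof -
    have "degree (monom (a i) (q ^ i)) < q ^ s" if "i < s" for i
      using degree_monom_le[of "a i" "q ^ i"] power_strict_increasing[OF that q_gt_1]
      by linarith
    then show ?thesis
      unfolding f_def using q_gt_1 by (intro degree_sum_less) auto
  qed
  ultimately have "f = 0"
    using card_GF_q[OF \<open>s > 0\<close>] q_gt_1
    by (intro poly_eqI_degree[of "GF (q ^ s)"]) auto
  then show ?thesis
    using coeff_sum_monom_q[of a s i] \<open>i < s\<close> unfolding f_def[symmetric] by simp
qed

lemma normal_basis_closed:
  assumes "normal_basis_generator q s \<beta>" "s dvd m"
  shows "\<beta> ^ (q ^ i) \<in> K"
  using assms GF_subset_K by (auto simp: normal_basis_generator_def intro!: power_closed)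

text \<open>An injective map of the finite set of vectors over \<open>K\<close> into itself is
  onto.\<close>

lemma hankel_surjective:
  assumes \<beta>: "normal_basis_generator q s \<beta>" and s: "s > 0" "s dvd m"
    and z: "\<And>j. j < s \<Longrightarrow> z j \<in> K"
  shows "\<exists>y. (\<forall>i<s. y i \<in> K) \<and> (\<forall>j<s. (\<Sum>i<s. \<beta> ^ (q ^ (i + j)) * y i) = z j)"
proof -
  define F where "F = (\<lambda>y. \<lambda>j\<in>{..<s}. \<Sum>i<s. \<beta> ^ (q ^ (i + j)) * y i)"
  let ?V = "{..<s} \<rightarrow>\<^sub>E K"
  have "F ` ?V = ?V"
  proof (rule endo_inj_surj)
    show "finite ?V" by (intro finite_PiE finite_K) auto
    show "F ` ?V \<subseteq> ?V"
      unfolding F_def using normal_basis_closed[OF \<beta> s(2)]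
      by (auto intro!: sum_closed mult_closed)
    show "inj_on F ?V"
    proof (rule inj_onI)
      fix y y' assume y: "y \<in> ?V" "y' \<in> ?V" and eq: "F y = F y'"
      have "y i - y' i = 0" if "i < s" for i
      proof (rule hankel_injective[OF \<beta> s(1) _ that])
        fix j assume "j < s"
        then show "(\<Sum>i<s. \<beta> ^ (q ^ (i + j)) * (y i - y' i)) = 0"
          using fun_cong[OF eq, of j]
          by (simp add: F_def right_diff_distrib sum_subtractf)
      qed
      with y show "y = y'" by (intro PiE_ext) auto
    qed
  qed
  moreover have "restrict z {..<s} \<in> ?V"
    using z by auto
  ultimately have "restrict z {..<s} \<in> F ` ?V"
    by simp
  then obtain y where y: "y \<in> ?V" "F y = restrict z {..<s}"
    by (elim imageE) simp
  have "(\<Sum>i<s. \<beta> ^ (q ^ (i + j)) * y i) = z j" if "j < s" for j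
    using fun_cong[OF y(2), of j] that by (simp add: F_def)
  with y(1) show ?thesis by (intro exI[of _ y]) auto
qed

text \<open>
  The matrix of the \<open>q\<close>-transform is a Hankel circulant.  Its inverse is one too, so it is
  determined by the solution \<open>g\<close> for the first unit vector.
\<close>

lemma hankel_inverse:
  assumes \<beta>: "normal_basis_generator q s \<beta>" and s: "s > 0" "s dvd m"
  obtains h where "\<And>t. h t \<in> K"
    and "\<And>y l. l < s \<Longrightarrow>
      (\<Sum>j<s. h (j + l) * (\<Sum>i<s. \<beta> ^ (q ^ (i + j)) * y i)) = (y l :: 'a)"
proof -
  have "\<exists>g. (\<forall>i<s. g i \<in> K) \<and>
      (\<forall>j<s. (\<Sum>i<s. \<beta> ^ (q ^ (i + j)) * g i) = (if j = 0 then 1 else 0))"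
    by (rule hankel_surjective[OF \<beta> s]) simp
  then obtain g where g: "\<And>i. i < s \<Longrightarrow> g i \<in> K"
    "\<And>j. j < s \<Longrightarrow> (\<Sum>i<s. \<beta> ^ (q ^ (i + j)) * g i) = (if j = 0 then 1 else 0)"
    by blast
  have \<beta>_GF: "\<beta> \<in> GF (q ^ s)"
    using \<beta> by (simp add: normal_basis_generator_def)
  have cong: "\<beta> ^ (q ^ t) = \<beta> ^ (q ^ t')" if "t mod s = t' mod s" for t t'
    using frobenius_period[OF \<beta>_GF] that by metis
  \<comment> \<open>Shifting the summation index cyclically by \<open>l\<close> reduces this to the
    defining equation of \<open>g\<close>; in the natural numbers \<open>s - l\<close> stands for
    \<open>- l\<close> modulo \<open>s\<close>.\<close>
  have unit: "(\<Sum>j<s. g ((j + l) mod s) * \<beta> ^ (q ^ (i + j))) = (if i = l then 1 else 0)"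
    if il: "i < s" "l < s" for i l
  proof -
    have "(\<Sum>j<s. g ((j + l) mod s) * \<beta> ^ (q ^ (i + j))) =
        (\<Sum>j<s. g j * \<beta> ^ (q ^ (j + (i + (s - l)))))"
    proof (rule sum.reindex_bij_witness[of _ "\<lambda>j. (j + (s - l)) mod s" "\<lambda>j. (j + l) mod s"])
      fix j assume j: "j \<in> {..<s}"
      have "((j + l) mod s + (s - l)) mod s = (j + l + (s - l)) mod s"
        by (rule mod_add_left_eq)
      also have "j + l + (s - l) = j + s"
        using il by simp
      finally show "((j + l) mod s + (s - l)) mod s = j"
        using j by simp
      have "((j + (s - l)) mod s + l) mod s = (j + (s - l) + l) mod s"
        by (rule mod_add_left_eq)
      also have "j + (s - l) + l = j + s"
        using il by simp
      finally show "((j + (s - l)) mod s + l) mod s = j"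
        using j by simp
      have "((j + l) mod s + (i + (s - l))) mod s = (j + l + (i + (s - l))) mod s"
        by (rule mod_add_left_eq)
      also have "j + l + (i + (s - l)) = i + j + s"
        using il by simp
      finally have "\<beta> ^ (q ^ ((j + l) mod s + (i + (s - l)))) = \<beta> ^ (q ^ (i + j))"
        by (intro cong) simp
      then show "g ((j + l) mod s) * \<beta> ^ (q ^ ((j + l) mod s + (i + (s - l)))) =
          g ((j + l) mod s) * \<beta> ^ (q ^ (i + j))"
        by simp
    qed (use s in auto)
    also have "\<dots> = (\<Sum>j<s. \<beta> ^ (q ^ (j + (i + (s - l)) mod s)) * g j)"
      by (intro sum.cong) (auto simp: mult.commute mod_add_right_eq intro!: cong)
    also have "\<dots> = (if (i + (s - l)) mod s = 0 then 1 else 0)"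
      using s by (intro g(2)) simp
    also have "(i + (s - l)) mod s = 0 \<longleftrightarrow> i = l"
    proof (cases "i < l")
      case True
      then show ?thesis using il by simp
    next
      case False
      then have "i + (s - l) = (i - l) + s"
        using il by simp
      then have "(i + (s - l)) mod s = (i - l) mod s"
        by (simp only: mod_add_self2)
      also have "\<dots> = i - l"
        using il by simp
      finally have eq: "(i + (s - l)) mod s = i - l" .
      show ?thesis
        unfolding eq using False by auto
    qed
    finally show ?thesis .
  qed
  show thesis
  proof
    show "g (t mod s) \<in> K" for t
      using s g(1) by simp
    fix y :: "nat \<Rightarrow> 'a" and l assume l: "l < s"
    have "(\<Sum>j<s. g ((j + l) mod s) * (\<Sum>i<s. \<beta> ^ (q ^ (i + j)) * y i)) =
        (\<Sum>i<s. (\<Sum>j<s. g ((j + l) mod s) * \<beta> ^ (q ^ (i + j))) * y i)"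
      unfolding sum_distrib_left sum_distrib_right by (subst sum.swap) (simp add: mult.assoc)
    also have "\<dots> = (\<Sum>i<s. if i = l then y i else 0)"
      using l by (intro sum.cong) (auto simp: unit)
    also have "\<dots> = y l" using l by simp
    finally show "(\<Sum>j<s. g ((j + l) mod s) * (\<Sum>i<s. \<beta> ^ (q ^ (i + j)) * y i)) = y l" .
  qed
qed

section \<open>Recognizing a generator by traces\<close>

text \<open>For \<gamma> and \<beta> in \<open>GF (q ^ s)\<close> this is the trace to
  \<open>GF q\<close> of \<open>\<gamma> ^ (q ^ j) * \<beta>\<close>. Expanded over conjugates it
  becomes a Hankel product of constants with the input values
  \<open>\<beta> ^ (q ^ i)\<close>.\<close>

definition trace_coordinate :: "nat \<Rightarrow> 'a \<Rightarrow> nat \<Rightarrow> 'a \<Rightarrow> 'a" where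
  "trace_coordinate s \<gamma> j \<beta> = (\<Sum>i<s. \<gamma> ^ (q ^ (i + j)) * \<beta> ^ (q ^ i))"

text \<open>Frobenius shifts the summands cyclically and so fixes their sum.\<close>

lemma trace_coordinate_in_GF:
  assumes "\<gamma> \<in> GF (q ^ s)" "\<beta> \<in> GF (q ^ s)"
  shows "trace_coordinate s \<gamma> j \<beta> \<in> GF q"
proof -
  define f where "f i = \<gamma> ^ (q ^ (i + j)) * \<beta> ^ (q ^ i)" for i
  have "f s = f 0"
    using frobenius_period[OF assms(1), of "s + j"] frobenius_period[OF assms(1), of j]
      frobenius_period[OF assms(2), of s] by (simp add: f_def)
  moreover have "(\<Sum>i<Suc s. f i) = f 0 + (\<Sum>i<s. f (Suc i))"
    by (rule sum.lessThan_Suc_shift)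
  ultimately have "(\<Sum>i<s. f (Suc i)) = (\<Sum>i<s. f i)"
    by simp
  moreover have "f i ^ q = f (Suc i)" for i
    by (simp add: f_def power_mult_distrib mult.commute flip: power_mult)
  ultimately have "(\<Sum>i<s. f i) ^ q = (\<Sum>i<s. f i)"
    using frobenius_sum[of f "{..<s}" 1] by simp
  then show ?thesis
    by (simp add: GF_def trace_coordinate_def f_def)
qed

text \<open>The differences of corresponding conjugates form a kernel vector of the Hankel matrix of
  \<gamma>; its entry of index 0 is the difference of \<beta> and \<open>\<beta>'\<close>.\<close>

lemma trace_coordinates_inject:
  assumes "normal_basis_generator q s \<gamma>" "s > 0"
    and "\<And>j. j < s \<Longrightarrow> trace_coordinate s \<gamma> j \<beta> = trace_coordinate s \<gamma> j \<beta>'"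
  shows "\<beta> = \<beta>'"
proof -
  have "\<beta> ^ (q ^ 0) - \<beta>' ^ (q ^ 0) = 0"
  proof (rule hankel_injective[OF assms(1,2), where a = "\<lambda>i. \<beta> ^ (q ^ i) - \<beta>' ^ (q ^ i)"])
    fix j assume "j < s"
    with assms(3) show "(\<Sum>i<s. \<gamma> ^ (q ^ (i + j)) * (\<beta> ^ (q ^ i) - \<beta>' ^ (q ^ i))) = 0"
      by (simp add: trace_coordinate_def right_diff_distrib sum_subtractf)
  qed (rule assms(2))
  then show ?thesis by simp
qed

section \<open>Computing the transforms\<close>

lemma lin_polys_expand:
  assumes a: "a \<in> lin_polys q K s"
  shows "a = (\<Sum>i<s. monom (coeff a (q ^ i)) (q ^ i))"
proof (rule poly_eqI)
  fix n
  show "coeff a n = coeff (\<Sum>i<s. monom (coeff a (q ^ i)) (q ^ i)) n"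
  proof (cases "\<exists>k. n = q ^ k")
    case True
    then obtain k where k: "n = q ^ k" by blast
    have "k < s" if nz: "coeff a (q ^ k) \<noteq> 0"
    proof -
      \<comment> \<open>\<open>q_degree\<close> is a \<open>Max\<close> and says something only
        about a finite set; finiteness follows from
        \<open>k' < 2 ^ k' \<le> q ^ k' \<le> degree a\<close>.\<close>
      have "k' \<le> degree a" if "coeff a (q ^ k') \<noteq> 0" for k'
        using le_degree[OF that] less_exp[of k'] power_mono[of 2 q k'] q_gt_1 by linarith
      then have "{k. coeff a (q ^ k) \<noteq> 0} \<subseteq> {..degree a}"
        by auto
      then have "finite {k. coeff a (q ^ k) \<noteq> 0}"
        by (rule finite_subset) simp
      then have "k \<le> q_degree q a"
        unfolding q_degree_def using nz by (intro Max_ge) auto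
      with a nz show ?thesis by (auto simp: lin_polys_def)
    qed
    then show ?thesis
      unfolding k coeff_sum_monom_q by auto
  next
    case False
    then have "coeff a n = 0"
      using a by (auto simp: lin_polys_def linearized_def)
    moreover have "coeff (\<Sum>i<s. monom (coeff a (q ^ i)) (q ^ i)) n = 0"
      using False by (auto simp: coeff_sum intro!: sum.neutral)
    ultimately show ?thesis by simp
  qed
qed

lemma sum_monom_in_lin_polys:
  assumes c: "\<And>i. i < s \<Longrightarrow> c i \<in> K"
  shows "(\<Sum>i<s. monom (c i) (q ^ i)) \<in> lin_polys q K s"
proof -
  let ?a = "\<Sum>i<s. monom (c i) (q ^ i)"
  have "coeff ?a i \<in> K" for i
    using c by (auto simp: coeff_sum intro!: sum_closed)
  moreover have "\<exists>k. i = q ^ k" if "coeff ?a i \<noteq> 0" for i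
  proof (rule ccontr)
    assume "\<nexists>k. i = q ^ k"
    then have "coeff ?a i = 0"
      by (auto simp: coeff_sum intro!: sum.neutral)
    with that show False by simp
  qed
  ultimately have lin: "linearized q K ?a"
    by (auto simp: linearized_def)
  have "q_degree q ?a < s" if nz: "?a \<noteq> 0"
  proof -
    have sub: "{k. coeff ?a (q ^ k) \<noteq> 0} \<subseteq> {..<s}"
      unfolding coeff_sum_monom_q by auto
    from nz obtain i where "coeff ?a i \<noteq> 0"
      using leading_coeff_neq_0 by blast
    with lin have "{k. coeff ?a (q ^ k) \<noteq> 0} \<noteq> {}"
      unfolding linearized_def by blast
    with sub show ?thesis
      unfolding q_degree_def
      by (subst Max_less_iff) (auto intro: finite_subset[OF sub])
  qed
  with lin show ?thesis by (auto simp: lin_polys_def)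
qed

lemma coeff_q_transform:
  assumes "a \<in> lin_polys q K s" "j < s"
  shows "coeff (q_transform q s \<beta> a) (q ^ j) = (\<Sum>i<s. \<beta> ^ (q ^ (i + j)) * coeff a (q ^ i))"
proof -
  have "coeff (q_transform q s \<beta> a) (q ^ j) = poly a (\<beta> ^ (q ^ j))"
    unfolding q_transform_def coeff_sum_monom_q using assms(2) by simp
  also have "\<dots> = (\<Sum>i<s. \<beta> ^ (q ^ (i + j)) * coeff a (q ^ i))"
    by (subst lin_polys_expand[OF assms(1)])
      (simp add: poly_sum poly_monom power_add mult.commute flip: power_mult)
  finally show ?thesis .
qed

text \<open>\<open>inv_into\<close> inverts only on the image of the transform;
  \<open>hankel_surjective\<close> places every \<open>a\<close> in that image.\<close>

lemma inv_q_transform: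
  assumes a: "a \<in> lin_polys q K s" and \<beta>: "normal_basis_generator q s \<beta>" and s: "s > 0" "s dvd m"
  shows "inv_q_transform q K s \<beta> a \<in> lin_polys q K s"
    and "q_transform q s \<beta> (inv_q_transform q K s \<beta> a) = a"
proof -
  have "coeff a (q ^ j) \<in> K" for j
    using a by (simp add: lin_polys_def linearized_def)
  then obtain y where y: "\<And>i. i < s \<Longrightarrow> y i \<in> K"
    "\<And>j. j < s \<Longrightarrow> (\<Sum>i<s. \<beta> ^ (q ^ (i + j)) * y i) = coeff a (q ^ j)"
    using hankel_surjective[OF \<beta> s, of "\<lambda>j. coeff a (q ^ j)"] by auto
  let ?b = "\<Sum>i<s. monom (y i) (q ^ i)"
  have b: "?b \<in> lin_polys q K s"
    using y(1) by (rule sum_monom_in_lin_polys)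
  have "q_transform q s \<beta> ?b = (\<Sum>j<s. monom (coeff (q_transform q s \<beta> ?b) (q ^ j)) (q ^ j))"
    unfolding q_transform_def coeff_sum_monom_q by (rule sum.cong) auto
  also have "\<dots> = (\<Sum>j<s. monom (coeff a (q ^ j)) (q ^ j))"
    using b y(2) by (intro sum.cong refl) (simp add: coeff_q_transform coeff_sum_monom_q)
  also have "\<dots> = a"
    by (rule lin_polys_expand[OF a, symmetric])
  finally have "a \<in> q_transform q s \<beta> ` lin_polys q K s"
    using b by (metis imageI)
  then show "inv_q_transform q K s \<beta> a \<in> lin_polys q K s"
    "q_transform q s \<beta> (inv_q_transform q K s \<beta> a) = a"
    unfolding inv_q_transform_def by (auto intro: inv_into_into f_inv_into_f)
qed

section \<open>Computation trees for both transforms\<close>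

text \<open>An instance is a pair of a polynomial and a generator; the order of the quantities is
  that of the input lists of both problems.\<close>

definition input_quantities :: "nat \<Rightarrow> ('a poly \<times> 'a \<Rightarrow> 'a) list" where
  "input_quantities s =
     map (\<lambda>i (a, \<beta>). coeff a (q ^ i)) [0..<s] @ map (\<lambda>i (a, \<beta>). \<beta> ^ (q ^ i)) [0..<s]"

text \<open>The reference generator \<gamma> is taken from any instance. The cost consists of one
  Hankel product for the traces, \<open>5 * q\<close> for testing each of the \<open>s\<close>
  traces, and \<open>c\<close> at the leaf.\<close>

lemma computes_identify_generator:
  fixes X :: "('a poly \<times> 'a) set"
  assumes s: "s > 0" "s dvd m" and k: "3 * s \<le> q ^ k" "q ^ k \<le> card K"
    and X: "\<And>x. x \<in> X \<Longrightarrow> normal_basis_generator q s (snd x)"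
    and leaf: "\<And>\<beta> S. normal_basis_generator q s \<beta> \<Longrightarrow> set (input_quantities s) \<subseteq> S \<Longrightarrow>
      computes {x\<in>X. snd x = \<beta>} S c gs"
  shows "computes X (set (input_quantities s)) (mult_cost k + 1 + (s * (5 * q) + c)) gs"
proof (cases "X = {}")
  case True
  then show ?thesis by (simp add: computes_def)
next
  case False
  then obtain \<gamma> :: 'a where \<gamma>: "normal_basis_generator q s \<gamma>"
    using X by blast
  let ?S = "set (input_quantities s)"
  let ?cs = "map (\<lambda>j (x :: 'a poly \<times> 'a). trace_coordinate s \<gamma> j (snd x)) [0..<s]"
  have input: "(\<lambda>(a, \<beta>). \<beta> ^ (q ^ i)) \<in> ?S" if "i < s" for i
    using that unfolding input_quantities_def by auto
  have eq: "set ?cs =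
      (\<lambda>j x. \<Sum>i<s. \<gamma> ^ (q ^ (i + j)) * (\<lambda>(a, \<beta>). \<beta> ^ (q ^ i)) x) ` {..<s}"
    by (auto simp: trace_coordinate_def case_prod_unfold)
  have traces: "derives ?S (mult_cost k + 1) (set ?cs)"
    unfolding eq by (intro derives_hankel k normal_basis_closed[OF \<gamma> s(2)] input)
  have "computes X (?S \<union> set ?cs) (length ?cs * (5 * card (GF q :: 'a set)) + c) gs"
  proof (rule computes_finite_cases_list)
    show "finite (GF q :: 'a set)"
      using finite_K GF_q_subset_K by (rule finite_subset[rotated])
    show "GF q \<subseteq> K" by (rule GF_q_subset_K)
    show "set ?cs \<subseteq> ?S \<union> set ?cs" by simp
    show "f x \<in> GF q" if "x \<in> X" "f \<in> set ?cs" for x f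
      using that \<gamma> X[OF that(1)] unfolding normal_basis_generator_def
      by (auto intro: trace_coordinate_in_GF)
    fix v
    let ?X = "{x \<in> X. \<forall>f\<in>set ?cs. f x = v f}"
    show "computes ?X (?S \<union> set ?cs) c gs"
    proof (cases "?X = {}")
      case True
      then show ?thesis unfolding computes_def by blast
    next
      case False
      then obtain x where x: "x \<in> ?X" by blast
      \<comment> \<open>Equal outcomes mean equal trace coordinates, so all inputs arriving at this
        leaf share one generator.\<close>
      have "snd y = snd x" if y: "y \<in> ?X" for y
      proof (rule trace_coordinates_inject[OF \<gamma> s(1)])
        fix j assume "j < s"
        then have "(\<lambda>x. trace_coordinate s \<gamma> j (snd x)) \<in> set ?cs" by auto
        with x y show "trace_coordinate s \<gamma> j (snd y) = trace_coordinate s \<gamma> j (snd x)"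
          by fastforce
      qed
      then have sub: "?X \<subseteq> {y \<in> X. snd y = snd x}" by blast
      have "computes {y \<in> X. snd y = snd x} (?S \<union> set ?cs) c gs"
        using x by (intro leaf X) auto
      then show ?thesis
        using sub by (rule computes_mono) auto
    qed
  qed
  then show ?thesis
    using derivesD[OF traces] by (simp add: card_GF_q1)
qed

text \<open>At a leaf the generator is known, so \<open>h\<close> can be built into the tree as
  constants.\<close>

lemma computes_hankel_leaf:
  fixes X :: "('a poly \<times> 'a) set"
  assumes k: "3 * s \<le> q ^ k" "q ^ k \<le> card K" and S: "set (input_quantities s) \<subseteq> S"
    and h: "\<And>t. h t \<in> K"
    and f: "\<And>x j. x \<in> X \<Longrightarrow> j < s \<Longrightarrow> f x j = (\<Sum>i<s. h (i + j) * coeff (fst x) (q ^ i))"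
  shows "computes X S (mult_cost k + 1) (map (\<lambda>j x. f x j) [0..<s])"
proof -
  let ?gs = "map (\<lambda>j x. \<Sum>i<s. h (i + j) * (\<lambda>(a, \<beta>). coeff a (q ^ i)) x) [0..<s]"
  have "(\<lambda>(a, \<beta>). coeff a (q ^ i)) \<in> S" if "i < s" for i
    using that S unfolding input_quantities_def by auto
  then have "derives S (mult_cost k + 1)
      ((\<lambda>j x. \<Sum>i<s. h (i + j) * (\<lambda>(a, \<beta>). coeff a (q ^ i)) x) ` {..<s})"
    using h by (intro derives_hankel k)
  then have "derives S (mult_cost k + 1) (set ?gs)"
    by (simp add: atLeast0LessThan)
  moreover have "computes X (S \<union> set ?gs) 0 ?gs"
    by (rule computes_return) simp
  ultimately have "computes X S (mult_cost k + 1 + 0) ?gs"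
    by (rule derivesD)
  then have "computes X S (mult_cost k + 1) ?gs"
    by simp
  then show ?thesis
    by (rule computes_cong) (auto simp: f case_prod_unfold)
qed

text \<open>Two Hankel products, one to find the generator and one to transform, plus
  \<open>5 * q * s\<close> for the tests.\<close>

lemma QT_le:
  assumes G: "G = galois_group K (GF q)"
    and s: "s > 0" "s dvd m" and k: "3 * s \<le> q ^ k" "q ^ k \<le> card K"
  shows "QT q K s \<le> enat (2 * mult_cost k + 5 * q * s + 2)"
proof -
  define X :: "('a poly \<times> 'a) set" where "X = {x. fst x \<in> lin_polys q K s \<and> normal_basis_generator q s (snd x)}"
  have cost: "mult_cost k + 1 + (s * (5 * q) + (mult_cost k + 1)) = 2 * mult_cost k + 5 * q * s + 2"
    by simp
  have input: "map (\<lambda>f. f x) (input_quantities s) =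
      q_coeffs q s (fst x) @ map (\<lambda>i. snd x ^ (q ^ i)) [0..<s]" for x
    by (simp add: input_quantities_def q_coeffs_def case_prod_unfold)
  \<comment> \<open>Both transforms fit one pattern: \<open>F\<close> yields the output polynomial,
    and for a fixed generator its coefficients are a Hankel product with constants
    \<open>h\<close>.\<close>
  have bound: "complexity K G ((\<lambda>x. (q_coeffs q s (fst x) @ map (\<lambda>i. snd x ^ (q ^ i)) [0..<s],
        q_coeffs q s (F x))) ` X) \<le> enat (2 * mult_cost k + 5 * q * s + 2)"
    if leaf: "\<And>\<beta> :: 'a. normal_basis_generator q s \<beta> \<Longrightarrow> \<exists>h. (\<forall>t. h t \<in> K) \<and>
      (\<forall>x j. x \<in> X \<longrightarrow> snd x = \<beta> \<longrightarrow> j < s \<longrightarrow>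
        coeff (F x) (q ^ j) = (\<Sum>i<s. h (i + j) * coeff (fst x) (q ^ i)))" for F
  proof -
    let ?gs = "map (\<lambda>j x. coeff (F x) (q ^ j)) [0..<s]"
    have "computes X (set (input_quantities s)) (mult_cost k + 1 + (s * (5 * q) + (mult_cost k + 1))) ?gs"
    proof (rule computes_identify_generator[OF s k])
      show "normal_basis_generator q s (snd x)" if "x \<in> X" for x
        using that by (simp add: X_def)
      fix \<beta> :: 'a and S assume "normal_basis_generator q s \<beta>" and S: "set (input_quantities s) \<subseteq> S"
      with leaf obtain h where "\<And>t. h t \<in> K" "\<And>x j. x \<in> X \<Longrightarrow> snd x = \<beta> \<Longrightarrow> j < s \<Longrightarrow>
          coeff (F x) (q ^ j) = (\<Sum>i<s. h (i + j) * coeff (fst x) (q ^ i))"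
        by blast
      then show "computes {x\<in>X. snd x = \<beta>} S (mult_cost k + 1) ?gs"
        by (intro computes_hankel_leaf[OF k S, of h]) auto
    qed
    from complexity_le[OF this] show ?thesis
      unfolding cost input by (simp add: q_coeffs_def comp_def)
  qed
  have "complexity K G (q_transform_problem q K s) \<le> enat (2 * mult_cost k + 5 * q * s + 2)"
  proof -
    have "q_transform_problem q K s =
        (\<lambda>x. (q_coeffs q s (fst x) @ map (\<lambda>i. snd x ^ (q ^ i)) [0..<s],
          q_coeffs q s (q_transform q s (snd x) (fst x)))) ` X"
      unfolding q_transform_problem_def X_def image_def Bex_def split_paired_Ex mem_Collect_eq
        fst_conv snd_conv
      by (rule Collect_cong) blast
    moreover have "\<exists>h. (\<forall>t. h t \<in> K) \<and> (\<forall>x j. x \<in> X \<longrightarrow> snd x = \<beta> \<longrightarrow> j < s \<longrightarrow>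
        coeff (q_transform q s (snd x) (fst x)) (q ^ j) =
          (\<Sum>i<s. h (i + j) * coeff (fst x) (q ^ i)))"
      if "normal_basis_generator q s \<beta>" for \<beta> :: 'a
      using normal_basis_closed[OF that s(2)]
      by (intro exI[of _ "\<lambda>t. \<beta> ^ (q ^ t)"]) (auto simp: X_def coeff_q_transform)
    ultimately show ?thesis using bound by simp
  qed
  moreover have "complexity K G (inv_q_transform_problem q K s) \<le> enat (2 * mult_cost k + 5 * q * s + 2)"
  proof -
    have "inv_q_transform_problem q K s =
        (\<lambda>x. (q_coeffs q s (fst x) @ map (\<lambda>i. snd x ^ (q ^ i)) [0..<s],
          q_coeffs q s (inv_q_transform q K s (snd x) (fst x)))) ` X"
      unfolding inv_q_transform_problem_def X_def image_def Bex_def split_paired_Ex mem_Collect_eq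
        fst_conv snd_conv
      by (rule Collect_cong) blast
    moreover have "\<exists>h. (\<forall>t. h t \<in> K) \<and> (\<forall>x j. x \<in> X \<longrightarrow> snd x = \<beta> \<longrightarrow> j < s \<longrightarrow>
        coeff (inv_q_transform q K s (snd x) (fst x)) (q ^ j) =
          (\<Sum>i<s. h (i + j) * coeff (fst x) (q ^ i)))"
      if \<beta>: "normal_basis_generator q s \<beta>" for \<beta> :: 'a
    proof -
      obtain h where h: "\<And>t. h t \<in> K" "\<And>y l. l < s \<Longrightarrow>
          (\<Sum>j<s. h (j + l) * (\<Sum>i<s. \<beta> ^ (q ^ (i + j)) * y i)) = (y l :: 'a)"
        using hankel_inverse[OF \<beta> s] by blast
      have "coeff (inv_q_transform q K s \<beta> a) (q ^ l) = (\<Sum>j<s. h (j + l) * coeff a (q ^ j))"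
        if a: "a \<in> lin_polys q K s" and l: "l < s" for a l
      proof -
        let ?b = "inv_q_transform q K s \<beta> a"
        \<comment> \<open>The transform of \<open>?b\<close> is \<open>a\<close>; applying the
          inverse Hankel matrix to this equation recovers \<open>?b\<close>.\<close>
        have "(\<Sum>i<s. \<beta> ^ (q ^ (i + j)) * coeff ?b (q ^ i)) = coeff a (q ^ j)" if "j < s" for j
          using coeff_q_transform[OF inv_q_transform(1)[OF a \<beta> s] that, of \<beta>]
            inv_q_transform(2)[OF a \<beta> s] by simp
        then show ?thesis
          using h(2)[OF l, of "\<lambda>i. coeff ?b (q ^ i)"] by simp
      qed
      with h(1) show ?thesis by (intro exI[of _ h]) (auto simp: X_def)
    qed
    ultimately show ?thesis using bound by simp
  qed
  ultimately show ?thesis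
    by (simp add: QT_def G)
qed

end

section \<open>Choice of the exponent and asymptotics\<close>

text \<open>The least \<open>k\<close> with \<open>3 * s \<le> q ^ k\<close> works: minimality
  bounds \<open>q ^ k\<close> by \<open>3 * q * s\<close> and \<open>k\<close> logarithmically. The
  bound \<open>k \<le> s\<close> ensures later that the field is large enough, as \<open>s\<close>
  divides \<open>m\<close>.\<close>

lemma exponent_exists:
  fixes q s :: nat
  assumes "q > 1" "s \<ge> 4"
  obtains k where "k \<le> s" "3 * s \<le> q ^ k" "q ^ k \<le> 3 * q * s" "real k + 1 \<le> 6 * ln s"
proof -
  define k where "k = (LEAST k. 3 * s \<le> q ^ k)"
  have "3 * s \<le> 2 ^ s"
    using \<open>s \<ge> 4\<close> by (induction s rule: dec_induct) auto
  also have "\<dots> \<le> q ^ s"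
    using assms by (intro power_mono) auto
  finally have s: "3 * s \<le> q ^ s" .
  then have k: "3 * s \<le> q ^ k"
    unfolding k_def by (rule LeastI)
  have "k \<le> s"
    unfolding k_def using s by (rule Least_le)
  have "k \<noteq> 0"
    using k assms by (intro notI) simp
  then have pred: "q ^ (k - 1) < 3 * s"
    using not_less_Least[of "k - 1" "\<lambda>k. 3 * s \<le> q ^ k"] by (simp add: k_def[symmetric])
  have "q ^ k = q * q ^ (k - 1)"
    using \<open>k \<noteq> 0\<close> by (cases k) auto
  then have "q ^ k \<le> 3 * q * s"
    using pred by (simp add: mult.assoc mult.left_commute[of q])
  have "2 ^ (k - 1) \<le> q ^ (k - 1)"
    using assms by (intro power_mono) auto
  also have "\<dots> < 3 * s" by (rule pred)
  also have "\<dots> \<le> s ^ 2"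
    using assms by (simp add: power2_eq_square)
  finally have "real (2 ^ (k - 1)) < real (s ^ 2)"
    by (simp only: of_nat_less_iff)
  then have "ln (2 ^ (k - 1)) < ln (real s ^ 2)"
    using assms by (subst ln_less_cancel_iff) auto
  then have less: "real (k - 1) * ln 2 < 2 * ln s"
    using assms by (simp add: ln_realpow)
  \<comment> \<open>Since e is at most 3, \<open>ln 2\<close> is at least 1/2, which turns
    \<open>2 * ln s\<close> into \<open>4 * ln s\<close>. Passing from \<open>k - 1\<close> to
    \<open>k + 1\<close> costs a further \<open>2 * ln s\<close>.\<close>
  have "1 \<le> ln ((2 :: real) ^ 2)"
    using exp_le by (subst ln_ge_iff) auto
  moreover have "ln ((2 :: real) ^ 2) = 2 * ln 2"
    by (subst ln_realpow) auto
  ultimately have "real (k - 1) * (1 / 2) \<le> real (k - 1) * ln 2"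
    by (intro mult_left_mono) linarith+
  with less have "real (k - 1) < 4 * ln s" by linarith
  moreover have "ln s \<ge> 1"
    using assms exp_le by (subst ln_ge_iff) auto
  ultimately have "real k + 1 \<le> 6 * ln s"
    using \<open>k \<noteq> 0\<close> by (simp add: of_nat_diff)
  then show thesis
    using that[of k] \<open>k \<le> s\<close> k \<open>q ^ k \<le> 3 * q * s\<close> by blast
qed

text \<open>\<open>C\<close> is fixed before \<open>s\<close> and \<open>m\<close>, so the bound is
  uniform in \<open>m\<close>.\<close>

theorem theorem12:
  fixes q e :: nat
  assumes "prime CHAR('a::alg_closed_field)" and "e > 0" and "q = CHAR('a) ^ e"
  shows "\<exists>C::real. \<forall>\<^sub>F s in sequentially. \<forall>m. m > 0 \<and> s dvd m \<longrightarrow>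
           ereal_of_enat (QT q (GF (q ^ m) :: 'a set) s)
             \<le> ereal (C * (real s * (ln (real s))\<^sup>2 * ln (ln (real s))))"
proof (intro exI)
  \<comment> \<open>\<open>2616 = 2 * 3 * 436\<close> with \<open>436 = 4 + 12 * 36\<close>: 36 is
    the square of the 6 bounding \<open>k + 1\<close>, while 3 and one power of \<open>q\<close>
    come from \<open>q ^ k \<le> 3 * q * s\<close>. The other summands cover the tests and the
    additive 2.\<close>
  define C where "C = 2616 * real q ^ 3 + 5 * real q + 2"
  show "\<forall>\<^sub>F s in sequentially. \<forall>m. m > 0 \<and> s dvd m \<longrightarrow>
      ereal_of_enat (QT q (GF (q ^ m) :: 'a set) s)
        \<le> ereal (C * (real s * (ln (real s))\<^sup>2 * ln (ln (real s))))"
    \<comment> \<open>From \<open>exp (exp 1)\<close> on, \<open>ln (ln s)\<close> is at least 1, so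
      that factor can be multiplied in at the end; 4 is the threshold of
      \<open>exponent_exists\<close>.\<close>
    using eventually_ge_at_top[of "max 4 (nat \<lceil>exp (exp (1 :: real))\<rceil>)"]
  proof (eventually_elim, intro allI impI)
    fix s m :: nat
    assume "max 4 (nat \<lceil>exp (exp (1 :: real))\<rceil>) \<le> s" and m: "m > 0 \<and> s dvd m"
    then have s: "s \<ge> 4" and "nat \<lceil>exp (exp (1 :: real))\<rceil> \<le> s"
      by simp_all
    from this(2) have "exp (exp (1 :: real)) \<le> real s"
      by (simp add: nat_le_iff ceiling_le_iff)
    then have "exp 1 \<le> ln (real s)"
      using s by (subst ln_ge_iff) auto
    moreover from this have lnln: "1 \<le> ln (ln (real s))"
      using exp_gt_zero[of "1 :: real"] by (subst ln_ge_iff) linarith+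
    moreover have "1 \<le> exp (1 :: real)" by simp
    ultimately have ln: "1 \<le> ln (real s)" by linarith
    interpret q_field q e m "GF (q ^ m) :: 'a set" "galois_group (GF (q ^ m)) (GF q)"
      by standard (use assms m in auto)
    obtain k where k: "k \<le> s" "3 * s \<le> q ^ k" "q ^ k \<le> 3 * q * s" "real k + 1 \<le> 6 * ln s"
      using exponent_exists[OF q_gt_1 s] by blast
    have "s \<le> m"
      using m by (intro dvd_imp_le) auto
    with k(1) have "k \<le> m" by linarith
    then have "q ^ k \<le> card (GF (q ^ m) :: 'a set)"
      unfolding card_K using q_gt_1 by (intro power_increasing) auto
    then have "QT q (GF (q ^ m) :: 'a set) s \<le> enat (2 * mult_cost k + 5 * q * s + 2)"
      using s m k(2) by (intro QT_le) auto
    then have "ereal_of_enat (QT q (GF (q ^ m) :: 'a set) s)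
        \<le> ereal_of_enat (enat (2 * mult_cost k + 5 * q * s + 2))"
      by (simp only: ereal_of_enat_le_iff)
    also have "\<dots> = ereal (2 * real (mult_cost k) + 5 * real q * real s + 2)"
      by simp
    also have "2 * real (mult_cost k) + 5 * real q * real s + 2
        \<le> C * (real s * (ln (real s))\<^sup>2 * ln (ln (real s)))"
    proof -
      let ?l = "ln (real s)"
      have q1: "1 \<le> real q" using q_gt_1 by simp
      have l2: "1 \<le> ?l\<^sup>2"
        using ln by (simp add: one_le_power)
      have "(real k + 1)\<^sup>2 \<le> (6 * ?l)\<^sup>2"
        using k(4) by (intro power_mono) auto
      then have "12 * real q ^ 2 * (real k + 1)\<^sup>2 \<le> 12 * real q ^ 2 * (6 * ?l)\<^sup>2"
        by (intro mult_left_mono) auto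
      moreover have "1 * 1 \<le> real q ^ 2 * ?l\<^sup>2"
        using q1 l2 by (intro mult_mono) (auto simp: one_le_power)
      ultimately have "4 + 12 * real q ^ 2 * (real k + 1)\<^sup>2 \<le> 436 * (real q ^ 2 * ?l\<^sup>2)"
        by (simp add: power_mult_distrib)
      moreover have "real (q ^ k) \<le> real (3 * q * s)"
        using k(3) by (simp only: of_nat_le_iff)
      ultimately have "real (q ^ k) * (4 + 12 * real q ^ 2 * (real k + 1)\<^sup>2)
          \<le> real (3 * q * s) * (436 * (real q ^ 2 * ?l\<^sup>2))"
        by (intro mult_mono) auto
      then have "real (mult_cost k) \<le> 1308 * real q ^ 3 * (real s * ?l\<^sup>2)"
        by (simp add: mult_cost_def power2_eq_square power3_eq_cube algebra_simps)
      moreover have sl: "real s * 1 \<le> real s * ?l\<^sup>2"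
        using l2 by (intro mult_left_mono) auto
      then have "5 * real q * (real s * 1) \<le> 5 * real q * (real s * ?l\<^sup>2)"
        using l2 by (intro mult_left_mono) auto
      moreover have "1 \<le> real s * ?l\<^sup>2"
        using sl s by linarith
      ultimately have "2 * real (mult_cost k) + 5 * real q * real s + 2 \<le> C * (real s * ?l\<^sup>2) * 1"
        by (simp add: C_def distrib_right)
      also have "\<dots> \<le> C * (real s * ?l\<^sup>2) * ln ?l"
        using lnln by (intro mult_left_mono) (auto simp: C_def)
      finally show ?thesis by (simp add: mult.assoc)
    qed
    finally show "ereal_of_enat (QT q (GF (q ^ m) :: 'a set) s)
        \<le> ereal (C * (real s * (ln (real s))\<^sup>2 * ln (ln (real s))))"
      by simp
  qed
qed

end
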